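(* Let $X$ and $Y$ be finite sets with $X\cap Y=\emptyset$, $\#X\geq 2$ and $\#Y\geq 2$, and let $k$ be an integer with $0<k<\#X+\#Y-2$. Let $\mathcal F_{X,Y}^k$ be the set of forests with vertex set $X\sqcup Y$ having exactly $k$ connected components and every edge of which joins a vertex of $X$ to a vertex of $Y$. Let $\Phi_{X,Y,k}=\sum_{F\in\mathcal F_{X,Y}^k}\prod_{e\in E(F)}x_e$ in the variables $x_e$, $e$ an edge of the complete bipartite graph $K_{X,Y}$, and let $\widetilde H_{\Phi_{X,Y,k}}$ be its Hessian matrix $\left(\frac{\partial^2\Phi_{X,Y,k}}{\partial x_e\partial x_{e'}}\right)_{e,e'}$ evaluated at $x_e=1$ for all $e$. Then $\det\widetilde H_{\Phi_{X,Y,k}}\neq 0$, and $\widetilde H_{\Phi_{X,Y,k}}$ has exactly one positive eigenvalue.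
   Context: The edges of $K_{X,Y}$ are the sets $\{x,y\}$ with $x\in X$, $y\in Y$. A forest is an acyclic graph; here it is a spanning acyclic subgraph of $K_{X,Y}$. *)

theory Defs
  imports
    "HOL-Analysis.Derivative"
    "Jordan_Normal_Form.Char_Poly"
begin

text \<open>A graph is a pair of a vertex set and an edge set; edges are two-element vertex sets.\<close>

type_synonym 'a graph = "'a set \<times> 'a set set"

definition simple_graph :: "'a graph \<Rightarrow> bool" where
  "simple_graph G \<longleftrightarrow> (\<forall>e\<in>snd G. e \<subseteq> fst G \<and> card e = 2)"

definition graph_cycle :: "'a graph \<Rightarrow> 'a list \<Rightarrow> bool" where
  "graph_cycle G vs \<longleftrightarrow> 3 \<le> length vs \<and> distinct vs \<and>
     (\<forall>i<length vs. {vs ! i, vs ! (Suc i mod length vs)} \<in> snd G)"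

definition is_forest :: "'a graph \<Rightarrow> bool" where
  "is_forest G \<longleftrightarrow> simple_graph G \<and> (\<nexists>vs. graph_cycle G vs)"

definition connected_rel :: "'a graph \<Rightarrow> ('a \<times> 'a) set" where
  "connected_rel G = {(u, v). u \<in> fst G \<and> v \<in> fst G \<and> (u, v) \<in> {(a, b). {a, b} \<in> snd G}\<^sup>*}"

definition conn_components :: "'a graph \<Rightarrow> 'a set set" where
  "conn_components G = fst G // connected_rel G"

definition bipartite_edges :: "'a set \<Rightarrow> 'a set \<Rightarrow> 'a set set" where
  "bipartite_edges X Y = {{x, y} |x y. x \<in> X \<and> y \<in> Y}"

definition bipartite_forests :: "'a set \<Rightarrow> 'a set \<Rightarrow> nat \<Rightarrow> 'a graph set" where
  "bipartite_forests X Y k =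
     {F. is_forest F \<and> fst F = X \<union> Y \<and> card (conn_components F) = k \<and>
         snd F \<subseteq> bipartite_edges X Y}"

text \<open>
  Polynomials in the variables \<open>x\<^sub>e\<close> are represented by the polynomial functions
  they induce on real assignments \<open>x\<close> of the variables, which is faithful over an infinite field;
  formal partial derivatives are then the usual ones.
\<close>

definition forest_poly :: "'a set \<Rightarrow> 'a set \<Rightarrow> nat \<Rightarrow> ('a set \<Rightarrow> real) \<Rightarrow> real" where
  "forest_poly X Y k x = (\<Sum>F\<in>bipartite_forests X Y k. \<Prod>e\<in>snd F. x e)"

definition partial_deriv :: "'v \<Rightarrow> (('v \<Rightarrow> real) \<Rightarrow> real) \<Rightarrow> ('v \<Rightarrow> real) \<Rightarrow> real" where
  "partial_deriv e f x = deriv (\<lambda>t. f (x(e := t))) (x e)"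

text \<open>The list \<open>es\<close> enumerates the variables and so fixes the order of rows and columns.\<close>

definition hessian :: "'v list \<Rightarrow> (('v \<Rightarrow> real) \<Rightarrow> real) \<Rightarrow> ('v \<Rightarrow> real) \<Rightarrow> real mat" where
  "hessian es f x = mat (length es) (length es)
     (\<lambda>(i, j). partial_deriv (es ! i) (partial_deriv (es ! j) f) x)"

text \<open>Eigenvalues are counted with algebraic multiplicity.\<close>

definition num_pos_eigenvalues :: "real mat \<Rightarrow> nat" where
  "num_pos_eigenvalues A = (\<Sum>c | eigenvalue A c \<and> 0 < c. order c (char_poly A))"

end

theory Submission
  imports Defs "HOL-Analysis.Function_Topology"
begin

text \<open>
  The forests with \<open>k\<close> components are the bases of the graphic matroid of \<open>K\<^sub>X\<^sub>,\<^sub>Y\<close> truncated to rank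
  \<open>r = #X + #Y - k\<close>, and this matroid is simple. For any simple matroid of rank \<open>r \<ge> 2\<close> the Hessian
  of the basis generating polynomial at the all-ones point is nondegenerate with one positive
  eigenvalue. Let \<open>H\<^sub>S\<close> be the Hessian for the contraction by an independent set \<open>S\<close>; argue by downward
  induction on \<open>#S\<close>. If \<open>#S = r - 2\<close>, then \<open>H\<^sub>S\<close> is the adjacency matrix of a complete multipartite
  graph. Otherwise put \<open>q = r - #S - 2\<close>. Euler's identity gives \<open>\<Sum>\<^sub>i H\<^sub>S\<^sub>+\<^sub>i = q H\<^sub>S\<close> and
  \<open>(H\<^sub>S\<^sub>+\<^sub>i 1)\<^sub>j = q (H\<^sub>S)\<^sub>i\<^sub>j\<close>, so that the reversed Cauchy-Schwarz inequalities for the \<open>H\<^sub>S\<^sub>+\<^sub>i\<close> add up to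
  \<open>\<langle>v, H\<^sub>S v\<rangle> \<le> \<langle>H\<^sub>S v, D\<^sup>-\<^sup>1 H\<^sub>S v\<rangle>\<close> with \<open>D = diag (H\<^sub>S 1)\<close>. Hence no eigenvalue of \<open>D\<^sup>-\<^sup>1 H\<^sub>S\<close> lies strictly
  between 0 and 1, while by Perron-Frobenius 1 is its largest eigenvalue and is simple.
  A vector in the kernel of \<open>H\<^sub>S\<close> turns all these inequalities into equalities and so lies in the
  kernel of every \<open>H\<^sub>S\<^sub>+\<^sub>i\<close>; inductively its sums over the parallel classes of the contraction vanish.
\<close>

section \<open>Symmetric bilinear forms with one positive direction\<close>

text \<open>For small \<open>t\<close> of the sign of \<open>b\<close> the linear term dominates.
  This is the first-variation argument behind the eigenvector equations and null vectors
  below.\<close>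

lemma linear_coeff_eq_zero_if_quadratic_nonpos:
  fixes b c :: real
  assumes "\<And>t. 2 * t * b + t\<^sup>2 * c \<le> 0"
  shows "b = 0"
proof (rule ccontr)
  assume b: "b \<noteq> 0"
  \<comment> \<open>With this choice \<open>t * b\<close> equals
    \<open>t\<^sup>2 * (1 + \<bar>c\<bar>)\<close>, which absorbs the quadratic term whatever the
    sign of \<open>c\<close>.\<close>
  define t where "t = b / (1 + \<bar>c\<bar>)"
  have pos: "1 + \<bar>c\<bar> > 0" by simp
  have tb: "t * b = t\<^sup>2 * (1 + \<bar>c\<bar>)"
    using pos by (simp add: t_def power2_eq_square)
  have t: "t\<^sup>2 > 0" using b by (simp add: t_def)
  have "2 * t * b + t\<^sup>2 * c = t\<^sup>2 * (2 + 2 * \<bar>c\<bar> + c)"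
    using tb by (simp add: algebra_simps)
  moreover have "\<dots> > 0"
    using t by (intro mult_pos_pos) auto
  ultimately show False using assms[of t] by linarith
qed

text \<open>Vectors are functions and the index set is a parameter, so a form and its restriction to
  a subset act on the same functions.\<close>

definition bform :: "'e set \<Rightarrow> ('e \<Rightarrow> 'e \<Rightarrow> real) \<Rightarrow> ('e \<Rightarrow> real) \<Rightarrow> ('e \<Rightarrow> real) \<Rightarrow> real" where
  "bform L h v w = (\<Sum>i\<in>L. \<Sum>j\<in>L. h i j * v i * w j)"

lemma bform_add_left: "bform L h (\<lambda>i. u i + v i) w = bform L h u w + bform L h v w"
  by (simp add: bform_def algebra_simps sum.distrib)

lemma bform_add_right: "bform L h w (\<lambda>i. u i + v i) = bform L h w u + bform L h w v"
  by (simp add: bform_def algebra_simps sum.distrib)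

lemma bform_scale_left: "bform L h (\<lambda>i. c * v i) w = c * bform L h v w"
  by (simp add: bform_def algebra_simps sum_distrib_left)

lemma bform_scale_right: "bform L h w (\<lambda>i. c * v i) = c * bform L h w v"
  by (simp add: bform_def algebra_simps sum_distrib_left)

lemma bform_commute:
  assumes "\<And>i j. h i j = h j i"
  shows "bform L h v w = bform L h w v"
  unfolding bform_def
  by (subst sum.swap) (simp add: assms mult.commute mult.left_commute)

lemma bform_eq_sum_left: "bform L h v w = (\<Sum>i\<in>L. v i * (\<Sum>j\<in>L. h i j * w j))"
  by (simp add: bform_def sum_distrib_left algebra_simps)

lemma bform_add_scale:
  assumes sym: "\<And>i j. h i j = h j i"
  shows "bform L h (\<lambda>i. v i + t * w i) (\<lambda>i. v i + t * w i) =
         bform L h v v + 2 * t * bform L h v w + t\<^sup>2 * bform L h w w"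
  by (simp add: bform_add_left bform_add_right bform_scale_left bform_scale_right
      bform_commute[where h = h and v = w and w = v, OF sym] power2_eq_square algebra_simps)


text \<open>Nonpositivity on one hyperplane leaves room for only one positive direction: a vector of
  positive value orthogonal to \<open>u\<close> would span with \<open>u\<close> a positive definite
  plane, and every plane meets the hyperplane.\<close>

lemma bform_nonpos_on_orthogonal:
  assumes sym: "\<And>i j. h i j = h j i"
    and ker: "\<And>v. (\<Sum>i\<in>L. a i * v i) = 0 \<Longrightarrow> bform L h v v \<le> 0"
    and pos: "0 < bform L h u u"
    and orth: "bform L h u v = 0"
  shows "bform L h v v \<le> 0"
proof -
  define \<phi> where "\<phi> = (\<lambda>v. \<Sum>i\<in>L. a i * v i)"
  have u: "\<phi> u \<noteq> 0" using ker[of u] pos unfolding \<phi>_def by linarith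
  \<comment> \<open>This moves \<open>v\<close> along \<open>u\<close> into the hyperplane. By
    orthogonality the move can only increase the value of the form.\<close>
  define t where "t = - \<phi> v / \<phi> u"
  have "\<phi> (\<lambda>i. v i + t * u i) = \<phi> v + t * \<phi> u"
    by (simp add: \<phi>_def algebra_simps sum.distrib sum_distrib_left)
  also have "\<dots> = 0" using u by (simp add: t_def)
  finally have "bform L h (\<lambda>i. v i + t * u i) (\<lambda>i. v i + t * u i) \<le> 0"
    unfolding \<phi>_def by (rule ker)
  then have "bform L h v v + t\<^sup>2 * bform L h u u \<le> 0"
    using orth by (simp add: bform_add_scale[OF sym] bform_commute[where h = h and v = v and w = u, OF sym])
  moreover have "t\<^sup>2 * bform L h u u \<ge> 0" using pos by simp
  ultimately show ?thesis by linarith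
qed

text \<open>The form is negative semidefinite on the orthogonal complement of \<open>u\<close>, so a
  null vector there pairs to zero with the whole complement, and it pairs to zero with
  \<open>u\<close> by assumption.\<close>

lemma bform_null_vector:
  assumes sym: "\<And>i j. h i j = h j i"
    and neg: "\<And>v. bform L h u v = 0 \<Longrightarrow> bform L h v v \<le> 0"
    and pos: "0 < bform L h u u"
    and orth: "bform L h u v = 0" and null: "bform L h v v = 0"
  shows "bform L h v w = 0"
proof -
  define s where "s = - bform L h u w / bform L h u u"
  define w' where "w' = (\<lambda>i. w i + s * u i)"
  have vu: "bform L h v u = 0" using orth bform_commute[where h = h and v = v and w = u, OF sym] by simp
  have uw': "bform L h u w' = 0"
    unfolding w'_def bform_add_right bform_scale_right using pos by (simp add: s_def)
  have vw': "bform L h v w' = bform L h v w"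
    using vu by (simp add: w'_def bform_add_right bform_scale_right)
  have "2 * t * bform L h v w' + t\<^sup>2 * bform L h w' w' \<le> 0" for t
  proof -
    have "bform L h u (\<lambda>i. v i + t * w' i) = 0"
      using orth uw' by (simp add: bform_add_right bform_scale_right)
    from neg[OF this] show ?thesis using null by (simp add: bform_add_scale[OF sym])
  qed
  then show ?thesis using linear_coeff_eq_zero_if_quadratic_nonpos vw' by metis
qed

lemma bform_indicator:
  assumes "finite L" "i \<in> L"
  shows "bform L h (\<lambda>j. if j = i then 1 else 0) v = (\<Sum>j\<in>L. h i j * v j)"
  using assms by (simp add: bform_eq_sum_left if_distrib[of "\<lambda>x. x * _"] sum.delta cong: if_cong)

text \<open>The component of \<open>v\<close> orthogonal to \<open>u\<close> has nonpositive value;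
  expanding that value gives the inequality.\<close>

lemma reversed_Cauchy_Schwarz:
  assumes sym: "\<And>i j. h i j = h j i"
    and neg: "\<And>v. bform L h u v = 0 \<Longrightarrow> bform L h v v \<le> 0"
    and pos: "0 < bform L h u u"
  shows "bform L h v v * bform L h u u \<le> (bform L h u v)\<^sup>2"
proof -
  define q where "q = bform L h u u"
  define b where "b = bform L h u v"
  define t where "t = - b / q"
  have q: "q > 0" using pos by (simp add: q_def)
  have "bform L h u (\<lambda>i. v i + t * u i) = 0"
    using q by (simp add: bform_add_right bform_scale_right flip: b_def q_def) (simp add: t_def)
  from neg[OF this] have "bform L h v v + 2 * t * b + t\<^sup>2 * q \<le> 0"
    by (simp add: bform_add_scale[OF sym] bform_commute[where h = h and v = v and w = u, OF sym] b_def q_def)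
  then have "bform L h v v \<le> b\<^sup>2 / q"
    using q by (simp add: t_def power2_eq_square)
  then show ?thesis using q by (simp add: b_def q_def pos_le_divide_eq)
qed

section \<open>Rayleigh quotients and the spectral gap argument\<close>

text \<open>Compactness provides a maximizer \<open>v\<close> of the form on the weighted unit
  sphere of a hyperplane, with maximum \<open>l\<close>. The last conclusion is its eigenvector
  equation, tested only against vectors of the hyperplane, so that no multiplier for the linear
  constraint appears.\<close>

lemma constrained_Rayleigh_maximizer:
  fixes h :: "'e \<Rightarrow> 'e \<Rightarrow> real" and d a :: "'e \<Rightarrow> real"
  assumes fin: "finite L" and sym: "\<And>i j. h i j = h j i"
    and d: "\<And>i. i \<in> L \<Longrightarrow> 0 < d i"
    and v0: "(\<Sum>i\<in>L. a i * v0 i) = 0" "i0 \<in> L" "v0 i0 \<noteq> 0"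
  obtains v l where "(\<Sum>i\<in>L. d i * (v i)\<^sup>2) = 1" "(\<Sum>i\<in>L. a i * v i) = 0"
    and "\<And>w. (\<Sum>i\<in>L. a i * w i) = 0 \<Longrightarrow> bform L h w w \<le> l * (\<Sum>i\<in>L. d i * (w i)\<^sup>2)"
    and "\<And>w. (\<Sum>i\<in>L. a i * w i) = 0 \<Longrightarrow> bform L h v w = l * (\<Sum>i\<in>L. d i * v i * w i)"
proof -
  \<comment> \<open>Functions live on the whole type, so those in \<open>K\<close> are made to
    vanish off \<open>L\<close>. On \<open>L\<close> the interval is the bound that weighted norm
    one imposes on a coordinate. As a product of compact sets, \<open>K\<close> is compact.\<close>
  define K where "K = PiE UNIV (\<lambda>i. if i \<in> L then {- (1 / sqrt (d i)) .. 1 / sqrt (d i)} else {0::real})"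
  define C where "C = {v. (\<Sum>i\<in>L. d i * (v i)\<^sup>2) = 1} \<inter> {v. (\<Sum>i\<in>L. a i * v i) = 0}"
  define norm2 where "norm2 = (\<lambda>w :: 'e \<Rightarrow> real. \<Sum>i\<in>L. d i * (w i)\<^sup>2)"
  have "compactin (product_topology (\<lambda>i. euclidean) UNIV) K"
    unfolding K_def compactin_PiE by auto
  then have "compact K" by (simp add: euclidean_product_topology)
  moreover have "closed C"
    unfolding C_def
    by (intro closed_Int closed_Collect_eq continuous_intros continuous_on_product_coordinates)
  ultimately have "compact (K \<inter> C)" by (rule compact_Int_closed)
  moreover have normalise: "(\<lambda>i. if i \<in> L then w i / sqrt (norm2 w) else 0) \<in> K \<inter> C"
    if "norm2 w > 0" "(\<Sum>i\<in>L. a i * w i) = 0" for w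
  proof -
    have sq: "d i * (w i)\<^sup>2 \<le> norm2 w" if "i \<in> L" for i
      unfolding norm2_def using fin d that
      by (intro member_le_sum) (auto intro!: mult_nonneg_nonneg simp: less_imp_le)
    have "\<bar>w i / sqrt (norm2 w)\<bar> \<le> 1 / sqrt (d i)" if "i \<in> L" for i
    proof -
      have "sqrt (d i * (w i)\<^sup>2) \<le> sqrt (norm2 w)" using sq[OF that] by simp
      then show ?thesis using d[OF that] \<open>norm2 w > 0\<close>
        by (simp add: real_sqrt_mult abs_divide field_simps)
    qed
    then have "(\<lambda>i. if i \<in> L then w i / sqrt (norm2 w) else 0) \<in> K"
      unfolding K_def by (auto simp: abs_le_iff minus_le_iff simp del: abs_divide)
    moreover have "(\<Sum>i\<in>L. d i * (w i / sqrt (norm2 w))\<^sup>2) = 1"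
      using that(1) by (simp add: power_divide flip: sum_divide_distrib) (simp add: norm2_def flip: sum_divide_distrib)
    moreover have "(\<Sum>i\<in>L. a i * (w i / sqrt (norm2 w))) = 0"
      using that(2) by (simp flip: sum_divide_distrib)
    ultimately show ?thesis by (simp add: C_def)
  qed
  have norm2_pos: "norm2 w > 0" if "i \<in> L" "w i \<noteq> 0" for w i
    unfolding norm2_def using fin d that
    by (intro sum_pos2[of L i]) (auto intro!: mult_nonneg_nonneg less_imp_le[OF d])
  have "K \<inter> C \<noteq> {}" using normalise[OF norm2_pos[where w = v0 and i = i0, OF v0(2,3)] v0(1)] by blast
  moreover have "continuous_on (K \<inter> C) (\<lambda>v. bform L h v v)"
    unfolding bform_def
    by (intro continuous_intros continuous_on_subset[OF continuous_on_product_coordinates]) auto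
  ultimately obtain v where v: "v \<in> K \<inter> C"
    and max: "\<And>w. w \<in> K \<inter> C \<Longrightarrow> bform L h w w \<le> bform L h v v"
    using continuous_attains_sup[of "K \<inter> C" "\<lambda>v. bform L h v v"] by blast
  define l where "l = bform L h v v"
  have v1: "norm2 v = 1" "(\<Sum>i\<in>L. a i * v i) = 0" using v by (auto simp: C_def norm2_def)
  have le: "bform L h w w \<le> l * norm2 w" if w: "(\<Sum>i\<in>L. a i * w i) = 0" for w
  proof (cases "\<exists>i\<in>L. w i \<noteq> 0")
    case True
    then have pos: "norm2 w > 0" using norm2_pos by blast
    let ?w = "\<lambda>i. if i \<in> L then w i / sqrt (norm2 w) else 0"
    have "bform L h ?w ?w = bform L h w w / norm2 w"
      using pos by (simp add: bform_def sum_divide_distrib)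
    with max[OF normalise[OF pos w]] pos show ?thesis
      by (simp add: l_def field_simps)
  next
    case False
    then show ?thesis by (simp add: bform_def norm2_def)
  qed
  have eq: "bform L h v w = l * (\<Sum>i\<in>L. d i * v i * w i)" if w: "(\<Sum>i\<in>L. a i * w i) = 0" for w
  proof -
    define e where "e = (\<Sum>i\<in>L. d i * v i * w i)"
    \<comment> \<open>The bound \<open>le\<close> is applied along the line through \<open>v\<close>
      in direction \<open>w\<close>; the constant terms cancel because \<open>v\<close> attains the
      maximum.\<close>
    have "2 * t * (bform L h v w - l * e) + t\<^sup>2 * (bform L h w w - l * norm2 w) \<le> 0" for t
    proof -
      have "(\<Sum>i\<in>L. a i * (v i + t * w i)) = (\<Sum>i\<in>L. a i * v i) + t * (\<Sum>i\<in>L. a i * w i)"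
        by (simp add: algebra_simps sum.distrib sum_distrib_left)
      then have "bform L h (\<lambda>i. v i + t * w i) (\<lambda>i. v i + t * w i) \<le> l * norm2 (\<lambda>i. v i + t * w i)"
        using v1 w by (intro le) simp
      moreover have "norm2 (\<lambda>i. v i + t * w i) = norm2 v + 2 * t * e + t\<^sup>2 * norm2 w"
        by (simp add: norm2_def e_def power2_eq_square algebra_simps sum.distrib sum_distrib_left)
      ultimately show ?thesis using v1 by (simp add: bform_add_scale[OF sym] algebra_simps flip: l_def)
    qed
    from linear_coeff_eq_zero_if_quadratic_nonpos[OF this] show ?thesis by (simp add: e_def)
  qed
  show ?thesis
    using that[of v l] v1 le eq by (simp add: norm2_def)
qed

text \<open>A positive maximum \<open>l\<close> of the Rayleigh quotient on the hyperplane is an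
  eigenvalue of \<open>h\<close> relative to the row sums. The hypothesis \<open>gap\<close> forces
  \<open>l \<ge> 1\<close>; the Dirichlet energy forces \<open>l \<le> 1\<close>, with equality only
  for functions constant along the edges. By \<open>conn\<close> these are constant, hence zero on
  the hyperplane.\<close>

lemma bform_nonpos_of_gap:
  fixes h :: "'e \<Rightarrow> 'e \<Rightarrow> real"
  defines "d \<equiv> \<lambda>L i. \<Sum>j\<in>L. h i j"
  assumes fin: "finite L" and sym: "\<And>i j. h i j = h j i"
    and nonneg: "\<And>i j. 0 \<le> h i j"
    and d: "\<And>i. i \<in> L \<Longrightarrow> 0 < d L i"
    and conn: "\<And>i j. i \<in> L \<Longrightarrow> j \<in> L \<Longrightarrow> 0 < h i j \<or> (\<exists>k\<in>L. 0 < h i k \<and> 0 < h k j)"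
    and gap: "\<And>v. bform L h v v \<le> (\<Sum>i\<in>L. (\<Sum>j\<in>L. h i j * v j)\<^sup>2 / d L i)"
    and orth: "(\<Sum>i\<in>L. d L i * v i) = 0"
  shows "bform L h v v \<le> 0"
proof (rule ccontr)
  assume neg: "\<not> bform L h v v \<le> 0"
  then obtain i0 where i0: "i0 \<in> L" "v i0 \<noteq> 0"
    using that by (cases "\<forall>i\<in>L. v i = 0") (auto simp: bform_def)
  obtain x l where x1: "(\<Sum>i\<in>L. d L i * (x i)\<^sup>2) = 1" and x0: "(\<Sum>i\<in>L. d L i * x i) = 0"
    and le: "\<And>w. (\<Sum>i\<in>L. d L i * w i) = 0 \<Longrightarrow> bform L h w w \<le> l * (\<Sum>i\<in>L. d L i * (w i)\<^sup>2)"
    and eq: "\<And>w. (\<Sum>i\<in>L. d L i * w i) = 0 \<Longrightarrow> bform L h x w = l * (\<Sum>i\<in>L. d L i * x i * w i)"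
    using constrained_Rayleigh_maximizer[where h = h and d = "d L", OF fin sym d orth i0] by blast
  have "0 < l * (\<Sum>i\<in>L. d L i * (v i)\<^sup>2)" using neg le[OF orth] by linarith
  moreover have "0 \<le> (\<Sum>i\<in>L. d L i * (v i)\<^sup>2)"
    by (intro sum_nonneg mult_nonneg_nonneg) (auto simp: less_imp_le d)
  ultimately have l: "l > 0" by (simp add: zero_less_mult_iff)
  have D: "(\<Sum>i\<in>L. d L i) > 0" using fin i0(1) d by (intro sum_pos) auto
  have x_one: "bform L h x (\<lambda>_. 1) = 0"
    using x0 by (simp add: bform_eq_sum_left d_def mult.commute)
  have eig: "(\<Sum>j\<in>L. h i j * x j) = l * (d L i * x i)" if i: "i \<in> L" for i
  proof -
    \<comment> \<open>The indicator of \<open>i\<close> is shifted by a constant into the hyperplane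
      to become an admissible test vector. The shift contributes nothing, since \<open>x\<close> is
      orthogonal to constants.\<close>
    define c where "c = - d L i / (\<Sum>i\<in>L. d L i)"
    let ?\<delta> = "\<lambda>j. if j = i then 1 else 0 :: real"
    have delta: "(\<Sum>j\<in>L. g j * ?\<delta> j) = g i" for g :: "'e \<Rightarrow> real"
      using fin i by (simp add: mult_delta_right)
    have "(\<Sum>j\<in>L. d L j * (?\<delta> j + c * 1)) = d L i + c * (\<Sum>j\<in>L. d L j)"
      unfolding distrib_left sum.distrib delta by (simp add: sum_distrib_left mult.commute)
    also have "\<dots> = 0" using D by (simp add: c_def)
    finally have "bform L h x (\<lambda>j. ?\<delta> j + c * 1) = l * (\<Sum>j\<in>L. d L j * x j * (?\<delta> j + c * 1))"
      by (rule eq)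
    also have "(\<Sum>j\<in>L. d L j * x j * (?\<delta> j + c * 1)) = d L i * x i + c * (\<Sum>j\<in>L. d L j * x j)"
      unfolding distrib_left sum.distrib delta by (simp add: sum_distrib_left mult.commute)
    finally have "bform L h x ?\<delta> = l * (d L i * x i)"
      unfolding bform_add_right bform_scale_right using x_one x0 by simp
    then show ?thesis
      using bform_indicator[OF fin i, of h x] bform_commute[where h = h and v = x and w = ?\<delta>, OF sym] by simp
  qed
  have xx: "bform L h x x = l"
    using eq[OF x0] x1 by (simp add: power2_eq_square mult.assoc)
  have "l \<le> (\<Sum>i\<in>L. (l * (d L i * x i))\<^sup>2 / d L i)"
    using gap[of x] by (simp add: xx eig cong: sum.cong)
  also have "\<dots> = (\<Sum>i\<in>L. l\<^sup>2 * (d L i * (x i)\<^sup>2))"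
    using d by (intro sum.cong refl) (simp add: power2_eq_square less_imp_neq[OF d, symmetric])
  also have "\<dots> = l\<^sup>2" using x1 by (simp flip: sum_distrib_left)
  finally have l1: "l \<ge> 1" using l by (simp add: power2_eq_square)
  \<comment> \<open>The Dirichlet energy of \<open>x\<close> is \<open>2 - 2 * l\<close>: both
    square terms are weighted norms, equal to one.\<close>
  have "(\<Sum>i\<in>L. \<Sum>j\<in>L. h i j * (x i - x j)\<^sup>2) =
        (\<Sum>i\<in>L. \<Sum>j\<in>L. h i j * (x i)\<^sup>2) + (\<Sum>i\<in>L. \<Sum>j\<in>L. h i j * (x j)\<^sup>2) - 2 * bform L h x x"
    by (simp add: bform_def power2_diff algebra_simps sum.distrib sum_subtractf sum_distrib_left)
  also have "(\<Sum>i\<in>L. \<Sum>j\<in>L. h i j * (x j)\<^sup>2) = (\<Sum>i\<in>L. \<Sum>j\<in>L. h i j * (x i)\<^sup>2)"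
    by (subst sum.swap) (simp add: sym)
  also have "(\<Sum>i\<in>L. \<Sum>j\<in>L. h i j * (x i)\<^sup>2) = 1"
    using x1 by (simp add: d_def sum_distrib_right)
  finally have "(\<Sum>i\<in>L. \<Sum>j\<in>L. h i j * (x i - x j)\<^sup>2) \<le> 0" using l1 xx by simp
  moreover have "0 \<le> (\<Sum>i\<in>L. \<Sum>j\<in>L. h i j * (x i - x j)\<^sup>2)"
    by (intro sum_nonneg mult_nonneg_nonneg nonneg) auto
  ultimately have "(\<Sum>i\<in>L. \<Sum>j\<in>L. h i j * (x i - x j)\<^sup>2) = 0" by linarith
  then have "h i j * (x i - x j)\<^sup>2 = 0" if "i \<in> L" "j \<in> L" for i j
    using that fin by (simp add: sum_nonneg_eq_0_iff sum_nonneg nonneg)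
  then have edge: "x i = x j" if "i \<in> L" "j \<in> L" "0 < h i j" for i j
    using that by force
  have "x i = x i0" if "i \<in> L" for i
    using conn[OF that i0(1)] edge that i0(1) by metis
  then have const: "(\<Sum>i\<in>L. d L i * x i) = (\<Sum>i\<in>L. d L i) * x i0"
    and const2: "(\<Sum>i\<in>L. d L i * (x i)\<^sup>2) = (\<Sum>i\<in>L. d L i) * (x i0)\<^sup>2"
    by (simp_all add: sum_distrib_right)
  from const x0 D have "x i0 = 0" by simp
  with const2 x1 show False by simp
qed

section \<open>Hessians of matroid basis generating polynomials\<close>

lemma bform_restrict:
  assumes "finite E" "L \<subseteq> E" "\<And>i j. i \<notin> L \<or> j \<notin> L \<Longrightarrow> h i j = 0"
  shows "bform E h v w = bform L h v w"
proof -
  have "(\<Sum>j\<in>E. h i j * v i * w j) = (\<Sum>j\<in>L. h i j * v i * w j)" for i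
    using assms by (intro sum.mono_neutral_right) auto
  then show ?thesis
    unfolding bform_def using assms by (auto intro!: sum.mono_neutral_right)
qed


section \<open>Sums over the classes of an equivalence relation\<close>

text \<open>Each class sum occurs once per member of the class and is divided by the number of
  members. Together \<open>rfl\<close> and \<open>cong\<close> make \<open>R\<close> an equivalence
  relation on \<open>L\<close>.\<close>

lemma equiv_class_sum:
  fixes f g :: "'e \<Rightarrow> real"
  assumes fin: "finite L"
    and rfl: "\<And>i. i \<in> L \<Longrightarrow> R i i"
    and cong: "\<And>i j k. i \<in> L \<Longrightarrow> j \<in> L \<Longrightarrow> k \<in> L \<Longrightarrow> R i j \<Longrightarrow> R i k = R j k"
    and g: "\<And>i j. i \<in> L \<Longrightarrow> j \<in> L \<Longrightarrow> R i j \<Longrightarrow> g i = g j"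
  shows "(\<Sum>i\<in>L. g i * f i) = (\<Sum>i\<in>L. g i * (\<Sum>j | j \<in> L \<and> R i j. f j) / card {j \<in> L. R i j})"
proof -
  define c where "c = (\<lambda>i. real (card {j \<in> L. R i j}))"
  have sym: "R i j = R j i" if "i \<in> L" "j \<in> L" for i j
    using that rfl cong by metis
  have cls: "{k \<in> L. R i k} = {k \<in> L. R j k}" if "i \<in> L" "j \<in> L" "R i j" for i j
    using cong that by blast
  have c0: "c i \<noteq> 0" if "i \<in> L" for i
    using fin rfl that by (auto simp: c_def card_eq_0_iff)
  have "(\<Sum>i\<in>L. g i * (\<Sum>j | j \<in> L \<and> R i j. f j) / c i) =
        (\<Sum>i\<in>L. \<Sum>j | j \<in> L \<and> R i j. g i * f j / c i)"
    by (simp add: sum_distrib_left sum_divide_distrib)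
  also have "\<dots> = (\<Sum>j\<in>L. \<Sum>i | i \<in> L \<and> R i j. g i * f j / c i)"
    using fin by (rule sum.swap_restrict[OF _ fin])
  also have "\<dots> = (\<Sum>j\<in>L. \<Sum>i | i \<in> L \<and> R j i. g j * f j / c j)"
  proof (intro sum.cong refl)
    fix j assume j: "j \<in> L"
    show "{i \<in> L. R i j} = {i \<in> L. R j i}" using sym j by blast
    fix i assume "i \<in> {i \<in> L. R j i}"
    then have i: "i \<in> L" "R j i" by auto
    show "g i * f j / c i = g j * f j / c j"
      using g[OF j i] cls[OF j i] by (simp add: c_def)
  qed
  also have "\<dots> = (\<Sum>j\<in>L. g j * f j)"
    using c0 by (intro sum.cong refl) (simp add: c_def)
  finally show ?thesis by (simp add: c_def)
qed

text \<open>Grouped by classes, the expression is the sum of the squares of the class sums.\<close>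

lemma sum_products_equiv_nonneg:
  fixes f :: "'e \<Rightarrow> real"
  assumes fin: "finite L"
    and rfl: "\<And>i. i \<in> L \<Longrightarrow> R i i"
    and cong: "\<And>i j k. i \<in> L \<Longrightarrow> j \<in> L \<Longrightarrow> k \<in> L \<Longrightarrow> R i j \<Longrightarrow> R i k = R j k"
  shows "0 \<le> (\<Sum>i\<in>L. (\<Sum>j | j \<in> L \<and> R i j. f j) * f i)"
proof -
  have "{k \<in> L. R i k} = {k \<in> L. R j k}" if "i \<in> L" "j \<in> L" "R i j" for i j
    using cong that by blast
  then have "(\<Sum>i\<in>L. (\<Sum>j | j \<in> L \<and> R i j. f j) * f i) =
    (\<Sum>i\<in>L. (\<Sum>j | j \<in> L \<and> R i j. f j) * (\<Sum>j | j \<in> L \<and> R i j. f j) / card {j \<in> L. R i j})"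
    by (intro equiv_class_sum fin rfl cong) auto
  also have "\<dots> \<ge> 0" by (intro sum_nonneg) simp
  finally show ?thesis .
qed

text \<open>If each of \<open>p\<close> classes has sum equal to the total \<open>s\<close>, then
  \<open>s = p * s\<close>, and \<open>p \<ge> 2\<close> gives \<open>s = 0\<close>.\<close>

lemma sum_zero_if_class_sums_total:
  fixes f :: "'e \<Rightarrow> real"
  assumes fin: "finite L"
    and rfl: "\<And>i. i \<in> L \<Longrightarrow> R i i"
    and cong: "\<And>i j k. i \<in> L \<Longrightarrow> j \<in> L \<Longrightarrow> k \<in> L \<Longrightarrow> R i j \<Longrightarrow> R i k = R j k"
    and total: "\<And>i. i \<in> L \<Longrightarrow> (\<Sum>j | j \<in> L \<and> R i j. f j) = (\<Sum>j\<in>L. f j)"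
    and two: "a \<in> L" "b \<in> L" "\<not> R a b"
  shows "(\<Sum>j\<in>L. f j) = 0"
proof -
  \<comment> \<open>Each class contributes one, so \<open>p\<close> is the number of
    classes.\<close>
  define p where "p = (\<Sum>i\<in>L. 1 / real (card {j \<in> L. R i j}))"
  have cls: "(\<Sum>i | i \<in> L \<and> R a i. 1 / real (card {j \<in> L. R i j})) = 1" if a: "a \<in> L" for a
  proof -
    have "(\<Sum>i | i \<in> L \<and> R a i. 1 / real (card {j \<in> L. R i j})) =
          (\<Sum>i | i \<in> L \<and> R a i. 1 / real (card {j \<in> L. R a j}))"
    proof (intro sum.cong refl)
      fix i assume "i \<in> {i \<in> L. R a i}"
      then have "{j \<in> L. R i j} = {j \<in> L. R a j}" using cong[OF a] by blast
      then show "1 / real (card {j \<in> L. R i j}) = 1 / real (card {j \<in> L. R a j})" by simp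
    qed
    moreover have "card {j \<in> L. R a j} \<noteq> 0" using a rfl fin by auto
    ultimately show ?thesis by simp
  qed
  have disj: "{i \<in> L. R a i} \<inter> {i \<in> L. R b i} = {}"
    using two cong rfl by blast
  have "2 = (\<Sum>i\<in>{i \<in> L. R a i} \<union> {i \<in> L. R b i}. 1 / real (card {j \<in> L. R i j}))"
    using fin cls two disj by (subst sum.union_disjoint) auto
  also have "\<dots> \<le> p" unfolding p_def using fin by (intro sum_mono2) auto
  finally have p: "p \<ge> 2" .
  have "(\<Sum>j\<in>L. f j) = (\<Sum>i\<in>L. 1 * (\<Sum>j | j \<in> L \<and> R i j. f j) / card {j \<in> L. R i j})"
    using equiv_class_sum[where g = "\<lambda>_. 1" and f = f and R = R, OF fin rfl cong] by simp
  also have "\<dots> = (\<Sum>j\<in>L. f j) * p"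
    unfolding p_def sum_distrib_left by (intro sum.cong refl) (simp add: total)
  finally have "(\<Sum>j\<in>L. f j) * (p - 1) = 0" by (simp add: algebra_simps)
  with p show ?thesis by auto
qed

section \<open>Matroids and the bases of their truncations\<close>

text \<open>Independent sets may have more than \<open>r\<close> elements. Truncation to rank
  \<open>r\<close> enters only through the bases, which are the independent sets of size
  \<open>r\<close>; \<open>rank_ge\<close> says that there is one.\<close>

locale finite_matroid =
  fixes E :: "'e set" and \<I> :: "'e set set" and r :: nat
  assumes finite_ground: "finite E"
    and indep_subset: "A \<in> \<I> \<Longrightarrow> A \<subseteq> E"
    and hereditary: "A \<in> \<I> \<Longrightarrow> B \<subseteq> A \<Longrightarrow> B \<in> \<I>"
    and augment: "A \<in> \<I> \<Longrightarrow> B \<in> \<I> \<Longrightarrow> card A < card B \<Longrightarrow> \<exists>x\<in>B - A. insert x A \<in> \<I>"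
    and rank_ge: "\<exists>B\<in>\<I>. card B = r"
begin

lemma indep_finite: "A \<in> \<I> \<Longrightarrow> finite A"
  using finite_ground indep_subset finite_subset by blast

lemma extend_to_rank:
  assumes "A \<in> \<I>" "card A \<le> r"
  shows "\<exists>B\<in>\<I>. card B = r \<and> A \<subseteq> B"
  using assms
proof (induction "r - card A" arbitrary: A)
  case 0
  then show ?case by (intro bexI[of _ A]) auto
next
  case (Suc n)
  obtain B where "B \<in> \<I>" "card B = r" using rank_ge by blast
  moreover have "card A < r" using Suc.hyps(2) by linarith
  ultimately obtain x where x: "x \<in> B - A" "insert x A \<in> \<I>"
    using augment[of A B] Suc.prems(1) by blast
  have "card (insert x A) = Suc (card A)" using x indep_finite[OF Suc.prems(1)] by simp
  then have "\<exists>B\<in>\<I>. card B = r \<and> insert x A \<subseteq> B"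
    using Suc.hyps(2) x(2) by (intro Suc.hyps(1)) linarith+
  then show ?case by blast
qed

text \<open>This is the value at the all-ones point of the derivative, in the variables of
  \<open>S\<close>, of the basis generating polynomial.\<close>

definition count_bases :: "'e set \<Rightarrow> real" where
  "count_bases S = card {B \<in> \<I>. card B = r \<and> S \<subseteq> B}"

lemma finite_indep: "finite \<I>"
  using finite_ground indep_subset by (meson PowI finite_Pow_iff finite_subset subsetI)

lemma count_bases_nonneg [simp]: "0 \<le> count_bases S"
  by (simp add: count_bases_def)

lemma count_bases_pos_iff: "0 < count_bases S \<longleftrightarrow> S \<in> \<I> \<and> card S \<le> r"
proof
  assume "0 < count_bases S"
  then obtain B where "B \<in> \<I>" "card B = r" "S \<subseteq> B"
    by (auto simp: count_bases_def card_gt_0_iff)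
  then show "S \<in> \<I> \<and> card S \<le> r" using hereditary indep_finite card_mono by metis
next
  assume "S \<in> \<I> \<and> card S \<le> r"
  then show "0 < count_bases S"
    using extend_to_rank finite_indep by (auto simp: count_bases_def card_gt_0_iff)
qed

lemma count_bases_eq_0: "S \<notin> \<I> \<Longrightarrow> count_bases S = 0"
  using count_bases_pos_iff[of S] count_bases_nonneg[of S] by linarith

lemma count_bases_full:
  assumes "S \<in> \<I>" "card S = r"
  shows "count_bases S = 1"
proof -
  have "{B \<in> \<I>. card B = r \<and> S \<subseteq> B} = {S}"
    using assms indep_finite card_subset_eq by blast
  then show ?thesis by (simp add: count_bases_def)
qed

text \<open>Pairs of a basis containing \<open>T\<close> and an element of it outside
  \<open>T\<close> are counted in two ways. This is Euler's identity for the derivative of the basis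
  generating polynomial by \<open>T\<close>.\<close>

lemma sum_count_bases_insert:
  assumes T: "T \<subseteq> E"
  shows "(\<Sum>k\<in>E - T. count_bases (insert k T)) = (real r - card T) * count_bases T"
proof -
  let ?\<B> = "{B \<in> \<I>. card B = r \<and> T \<subseteq> B}"
  have "(\<Sum>k\<in>E - T. count_bases (insert k T)) = (\<Sum>k\<in>E - T. \<Sum>B | B \<in> ?\<B> \<and> k \<in> B. 1)"
    by (intro sum.cong refl) (auto simp: count_bases_def intro!: arg_cong[where f = card])
  also have "\<dots> = (\<Sum>B\<in>?\<B>. \<Sum>k | k \<in> E - T \<and> k \<in> B. 1)"
    using finite_ground finite_indep by (intro sum.swap_restrict) auto
  also have "\<dots> = (\<Sum>B\<in>?\<B>. real r - card T)"
  proof (intro sum.cong refl)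
    fix B assume B: "B \<in> ?\<B>"
    then have "{k \<in> E - T. k \<in> B} = B - T" using indep_subset by blast
    moreover have "finite B" "finite T" "T \<subseteq> B" using B indep_finite finite_subset by auto
    then have "card (B - T) = card B - card T" "card T \<le> card B"
      by (simp_all add: card_Diff_subset card_mono)
    ultimately show "(\<Sum>k | k \<in> E - T \<and> k \<in> B. 1) = real r - card T" using B by simp
  qed
  finally show ?thesis by (simp add: count_bases_def)
qed

text \<open>The Hessian at the all-ones point of the basis generating polynomial of the contraction by
  \<open>S\<close> of the rank-\<open>r\<close> truncation, extended by zero to the elements of \<open>S\<close>.\<close>

definition hess :: "'e set \<Rightarrow> 'e \<Rightarrow> 'e \<Rightarrow> real" where
  "hess S j k = (if j \<noteq> k \<and> j \<notin> S \<and> k \<notin> S then count_bases (insert j (insert k S)) else 0)"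

lemma hess_sym: "hess S j k = hess S k j"
  by (simp add: hess_def insert_commute)

lemma hess_nonneg: "0 \<le> hess S j k"
  by (simp add: hess_def)

section \<open>Nonloops and parallel classes of contractions\<close>

definition nonloops :: "'e set \<Rightarrow> 'e set" where
  "nonloops S = {i \<in> E - S. insert i S \<in> \<I>}"

text \<open>For independent \<open>T\<close> and \<open>j\<close> in \<open>E\<close> this is
  membership in the closure. Elements outside \<open>E\<close> count as spanned, and a dependent set
  spans everything. Nonloops \<open>i\<close> and \<open>j\<close> of the contraction by
  \<open>S\<close> are parallel when \<open>spans (insert i S) j\<close>.\<close>

definition spans :: "'e set \<Rightarrow> 'e \<Rightarrow> bool" where
  "spans T j \<longleftrightarrow> j \<in> T \<or> insert j T \<notin> \<I>"

lemma finite_nonloops: "finite (nonloops S)"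
  using finite_ground by (simp add: nonloops_def)

lemma nonloops_subset: "nonloops S \<subseteq> E"
  by (auto simp: nonloops_def)

lemma spans_mono: "spans A j \<Longrightarrow> A \<subseteq> B \<Longrightarrow> spans B j"
  unfolding spans_def using hereditary by (meson insert_mono subsetD)

text \<open>Otherwise \<open>insert x T2\<close> is independent and larger than \<open>T1\<close>,
  and augmentation would add to \<open>T1\<close> one of its elements. But \<open>x\<close> already
  lies in \<open>T1\<close>, and the others are spanned by \<open>T1\<close>.\<close>

lemma spans_exchange:
  assumes T: "T1 \<in> \<I>" "T2 \<in> \<I>" "card T1 = card T2"
    and span: "\<And>x. x \<in> T2 \<Longrightarrow> spans T1 x"
  shows "x \<in> T1 \<Longrightarrow> spans T2 x"
proof (rule ccontr)
  assume x: "x \<in> T1" "\<not> spans T2 x"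
  then have "insert x T2 \<in> \<I>" "card T1 < card (insert x T2)"
    using T indep_finite[of T2] by (auto simp: spans_def)
  from augment[OF T(1) this] show False using x span by (auto simp: spans_def)
qed

lemma spans_cong:
  assumes T: "T1 \<in> \<I>" "T2 \<in> \<I>" "card T1 = card T2"
    and span: "\<And>x. x \<in> T2 \<Longrightarrow> spans T1 x"
  shows "spans T1 j = spans T2 j"
proof -
  \<comment> \<open>Two augmentations collide. Since \<open>T2\<close> spans \<open>j\<close>, the
    first enlarges \<open>T2\<close> by an element of \<open>T1\<close>; the second then adds to
    \<open>T1\<close> an element of \<open>T2\<close>, which \<open>T1\<close> spans.\<close>
  have le: "spans T1 j" if T: "T1 \<in> \<I>" "T2 \<in> \<I>" "card T1 = card T2"
    and span: "\<And>x. x \<in> T2 \<Longrightarrow> spans T1 x" and j: "spans T2 j" for T1 T2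
  proof (rule ccontr)
    assume nj: "\<not> spans T1 j"
    then have "insert j T1 \<in> \<I>" "card T2 < card (insert j T1)"
      using T indep_finite[of T1] by (auto simp: spans_def)
    from augment[OF T(2) this] obtain x where x: "x \<in> insert j T1 - T2" "insert x T2 \<in> \<I>" by blast
    then have "card T1 < card (insert x T2)" using T indep_finite[of T2] by simp
    from augment[OF T(1) x(2) this] x j span show False by (auto simp: spans_def)
  qed
  show ?thesis using le[OF T span] le[OF T(2,1) T(3)[symmetric] spans_exchange[OF T span]] by blast
qed

lemma card_insert_nonloop: "i \<in> nonloops S \<Longrightarrow> S \<in> \<I> \<Longrightarrow> card (insert i S) = Suc (card S)"
  using indep_finite by (simp add: nonloops_def)

text \<open>With \<open>spans_self\<close> this makes parallelism an equivalence relation on the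
  nonloops, in the form required by \<open>equiv_class_sum\<close>.\<close>

lemma parallel_cong:
  assumes S: "S \<in> \<I>" and ij: "i \<in> nonloops S" "j \<in> nonloops S" and par: "spans (insert i S) j"
  shows "spans (insert i S) k = spans (insert j S) k"
proof (rule spans_cong)
  show "spans (insert i S) x" if "x \<in> insert j S" for x
    using that par by (auto simp: spans_def)
  show "card (insert i S) = card (insert j S)" using S ij by (simp add: card_insert_nonloop)
qed (use ij in \<open>auto simp: nonloops_def\<close>)

lemma nonloops_insert:
  assumes "S \<in> \<I>" "i \<in> nonloops S"
  shows "nonloops (insert i S) = {j \<in> nonloops S. \<not> spans (insert i S) j}"
  unfolding nonloops_def spans_def using hereditary
  by (auto intro: hereditary[of "insert _ (insert i S)"])

lemma two_nonparallel:
  assumes "S \<in> \<I>" "card S + 2 \<le> r"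
  obtains a b where "a \<in> nonloops S" "b \<in> nonloops S" "\<not> spans (insert a S) b"
proof -
  obtain B where B: "B \<in> \<I>" "card B = r" "S \<subseteq> B"
    using extend_to_rank assms by (metis add_leD1)
  then have "2 \<le> card (B - S)"
    using assms indep_finite by (subst card_Diff_subset) auto
  then obtain T where T: "T \<subseteq> B - S" "card T = 2" by (meson obtain_subset_with_card_n)
  then obtain a b where ab: "T = {a, b}" "a \<noteq> b" by (auto simp: card_2_iff)
  have "insert b (insert a S) \<in> \<I>" "insert a S \<in> \<I>" "insert b S \<in> \<I>"
    using B T ab by (auto intro: hereditary[OF B(1)])
  then show ?thesis
    using T ab B indep_subset by (intro that[of a b]) (auto simp: nonloops_def spans_def)
qed

text \<open>Of two nonparallel elements at least one is not parallel to \<open>i\<close>, since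
  parallelism is transitive.\<close>

lemma nonparallel_exists:
  assumes "S \<in> \<I>" "card S + 2 \<le> r" and i: "i \<in> nonloops S"
  obtains k where "k \<in> nonloops S" "\<not> spans (insert i S) k"
proof -
  obtain a b where ab: "a \<in> nonloops S" "b \<in> nonloops S" "\<not> spans (insert a S) b"
    using two_nonparallel assms by blast
  show ?thesis
    using ab that[of a] that[of b] parallel_cong[OF assms(1) i ab(1)] by blast
qed

text \<open>The support of the Hessian is thus a complete multipartite graph with the parallel
  classes as parts: an independent set of at most \<open>r\<close> elements extends to a
  basis.\<close>

lemma hess_pos_iff:
  assumes "S \<in> \<I>" "card S + 2 \<le> r"
  shows "0 < hess S i j \<longleftrightarrow> i \<in> nonloops S \<and> j \<in> nonloops S \<and> \<not> spans (insert i S) j"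
proof
  assume "0 < hess S i j"
  then have ij: "i \<noteq> j" "i \<notin> S" "j \<notin> S" "insert i (insert j S) \<in> \<I>"
    by (auto simp: hess_def count_bases_pos_iff split: if_splits)
  then have "insert i S \<in> \<I>" "insert j S \<in> \<I>"
    by (auto intro: hereditary)
  with ij indep_subset[OF ij(4)]
  show "i \<in> nonloops S \<and> j \<in> nonloops S \<and> \<not> spans (insert i S) j"
    by (auto simp: nonloops_def spans_def insert_commute)
next
  assume "i \<in> nonloops S \<and> j \<in> nonloops S \<and> \<not> spans (insert i S) j"
  then show "0 < hess S i j"
    using assms indep_finite[OF assms(1)]
    by (auto simp: nonloops_def spans_def hess_def count_bases_pos_iff insert_commute)
qed

lemma hess_eq_0:
  assumes "S \<in> \<I>" "card S + 2 \<le> r" "i \<notin> nonloops S \<or> j \<notin> nonloops S \<or> spans (insert i S) j"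
  shows "hess S i j = 0"
  using hess_pos_iff[OF assms(1,2), of i j] hess_nonneg[of S i j] assms(3) by linarith


lemma bform_hess_restrict:
  assumes "S \<in> \<I>" "card S + 2 \<le> r"
  shows "bform E (hess S) v w = bform (nonloops S) (hess S) v w"
  using hess_eq_0[OF assms] by (intro bform_restrict finite_ground nonloops_subset) blast

lemma sum_hess_restrict:
  assumes "S \<in> \<I>" "card S + 2 \<le> r"
  shows "(\<Sum>j\<in>E. hess S i j * v j) = (\<Sum>j\<in>nonloops S. hess S i j * v j)"
  using hess_eq_0[OF assms] finite_ground nonloops_subset by (intro sum.mono_neutral_right) auto

section \<open>Euler's identity for the Hessians of contractions\<close>

lemma hess_row_sum:
  assumes "S \<subseteq> E" "i \<in> E" "i \<notin> S"
  shows "(\<Sum>k\<in>E. hess S i k) = (real r - card S - 1) * count_bases (insert i S)"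
proof -
  have "(\<Sum>k\<in>E. hess S i k) = (\<Sum>k\<in>E - insert i S. count_bases (insert k (insert i S)))"
    using assms finite_ground
    by (intro sum.mono_neutral_cong_right) (auto simp: hess_def insert_commute)
  also have "\<dots> = (real r - card (insert i S)) * count_bases (insert i S)"
    using assms by (intro sum_count_bases_insert) auto
  also have "card (insert i S) = Suc (card S)"
    using assms finite_subset[OF assms(1) finite_ground] by auto
  finally show ?thesis by (simp add: algebra_simps)
qed

text \<open>The bases containing \<open>S\<close>, \<open>i\<close> and \<open>j\<close> give both a
  first derivative for the contraction by \<open>insert i S\<close> and an entry of the Hessian for
  \<open>S\<close>; Euler's identity links them.\<close>

lemma hess_insert_row_sum:
  assumes "S \<subseteq> E" "i \<in> E" "i \<notin> S" "j \<in> E"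
  shows "(\<Sum>k\<in>E. hess (insert i S) j k) = (real r - card S - 2) * hess S i j"
proof (cases "j \<in> insert i S")
  case True
  then show ?thesis using assms by (auto simp: hess_def)
next
  case False
  have "card (insert i S) = Suc (card S)"
    using assms finite_subset[OF assms(1) finite_ground] by auto
  then show ?thesis using hess_row_sum[of "insert i S" j] False assms
    by (auto simp: hess_def insert_commute)
qed

lemma sum_hess_insert:
  assumes "S \<subseteq> E" "j \<in> E" "k \<in> E"
  shows "(\<Sum>i\<in>E - S. hess (insert i S) j k) = (real r - card S - 2) * hess S j k"
proof (cases "j \<noteq> k \<and> j \<notin> S \<and> k \<notin> S")
  case True
  let ?T = "insert j (insert k S)"
  have "(\<Sum>i\<in>E - S. hess (insert i S) j k) = (\<Sum>i\<in>E - ?T. count_bases (insert i ?T))"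
    using True finite_ground
    by (intro sum.mono_neutral_cong_right) (auto simp: hess_def insert_commute)
  also have "\<dots> = (real r - card ?T) * count_bases ?T"
    using assms by (intro sum_count_bases_insert) auto
  also have "card ?T = Suc (Suc (card S))"
    using assms True finite_subset[OF assms(1) finite_ground] by auto
  finally show ?thesis using True by (simp add: hess_def algebra_simps)
qed (auto simp: hess_def)

text \<open>This evaluates the right-hand side of the reversed Cauchy-Schwarz inequality for
  \<open>hess (insert i S)\<close> in terms of the vector \<open>hess S\<close> times
  \<open>v\<close>.\<close>

lemma bform_hess_insert_one:
  assumes "S \<subseteq> E" "i \<in> E" "i \<notin> S"
  shows "bform E (hess (insert i S)) (\<lambda>_. 1) v = (real r - card S - 2) * (\<Sum>j\<in>E. hess S i j * v j)"
proof -
  have "bform E (hess (insert i S)) (\<lambda>_. 1) v = (\<Sum>j\<in>E. v j * (\<Sum>k\<in>E. hess (insert i S) j k))"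
    by (subst bform_commute[OF hess_sym]) (simp add: bform_eq_sum_left)
  also have "\<dots> = (\<Sum>j\<in>E. v j * ((real r - card S - 2) * hess S i j))"
    using hess_insert_row_sum[OF assms] by simp
  finally show ?thesis by (simp add: sum_distrib_left algebra_simps)
qed

text \<open>Adding a loop of the contraction gives the zero Hessian, so the sum may run over
  \<open>E - S\<close>, where Euler's identity holds entrywise.\<close>

lemma sum_bform_hess_insert:
  assumes "S \<subseteq> E"
  shows "(\<Sum>i\<in>nonloops S. bform E (hess (insert i S)) v v) =
         (real r - card S - 2) * bform E (hess S) v v"
proof -
  have "bform E (hess (insert i S)) v v = 0" if "i \<in> E - S - nonloops S" for i
  proof -
    have "hess (insert i S) j k = 0" for j k
    proof -
      have "insert i S \<notin> \<I>" using that by (auto simp: nonloops_def)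
      then have "insert j (insert k (insert i S)) \<notin> \<I>" using hereditary by blast
      then show ?thesis by (simp add: hess_def count_bases_eq_0)
    qed
    then show ?thesis by (simp add: bform_def)
  qed
  then have "(\<Sum>i\<in>nonloops S. bform E (hess (insert i S)) v v) =
        (\<Sum>i\<in>E - S. bform E (hess (insert i S)) v v)"
    using finite_ground by (intro sum.mono_neutral_left) (auto simp: nonloops_def)
  also have "\<dots> = (\<Sum>j\<in>E. \<Sum>k\<in>E. (\<Sum>i\<in>E - S. hess (insert i S) j k) * v j * v k)"
    unfolding bform_def sum_distrib_right
    by (rule trans[OF sum.swap]) (intro sum.cong refl sum.swap)
  also have "\<dots> = (\<Sum>j\<in>E. \<Sum>k\<in>E. (real r - card S - 2) * hess S j k * v j * v k)"
    using sum_hess_insert[OF assms] by simp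
  finally show ?thesis by (simp add: bform_def sum_distrib_left algebra_simps)
qed

section \<open>One positive direction\<close>

lemma hess_row_pos:
  assumes "S \<in> \<I>" "card S + 2 \<le> r" "i \<in> nonloops S"
  shows "0 < (\<Sum>j\<in>nonloops S. hess S i j)"
proof -
  obtain k where "k \<in> nonloops S" "\<not> spans (insert i S) k"
    using nonparallel_exists assms by blast
  then show ?thesis
    using assms finite_nonloops hess_pos_iff[OF assms(1,2)]
    by (intro sum_pos2[of _ k]) (auto simp: hess_nonneg)
qed

lemma bform_hess_one_pos:
  assumes "S \<in> \<I>" "card S + 2 \<le> r"
  shows "0 < bform E (hess S) (\<lambda>_. 1) (\<lambda>_. 1)"
proof -
  obtain a where a: "a \<in> nonloops S" using two_nonparallel assms by blast
  have "0 < (\<Sum>i\<in>nonloops S. \<Sum>j\<in>nonloops S. hess S i j)"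
    by (rule sum_pos2[OF finite_nonloops a]) (simp_all add: hess_row_pos[OF assms a] sum_nonneg hess_nonneg)
  then show ?thesis by (simp add: bform_hess_restrict[OF assms]) (simp add: bform_def)
qed

text \<open>Adding \<open>i\<close> and \<open>j\<close> already reaches size \<open>r\<close>, so
  at most one basis is counted. The difference splits the matrix into an all-ones part and a block
  part.\<close>

lemma hess_corank_two:
  assumes "S \<in> \<I>" "card S + 2 = r" "i \<in> nonloops S" "j \<in> nonloops S"
  shows "hess S i j = 1 - (if spans (insert i S) j then 1 else 0)"
proof (cases "spans (insert i S) j")
  case False
  then have "i \<noteq> j" "i \<notin> S" "j \<notin> S" "insert i (insert j S) \<in> \<I>"
    using assms by (auto simp: spans_def nonloops_def insert_commute)
  moreover from this have "card (insert i (insert j S)) = r"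
    using assms indep_finite[OF assms(1)] by simp
  ultimately show ?thesis using False by (simp add: hess_def count_bases_full)
qed (use assms hess_eq_0 in auto)

lemma spans_self: "spans (insert i S) i"
  by (simp add: spans_def)

text \<open>The induction is on the corank \<open>n + 2\<close> of \<open>S\<close>. Together with
  \<open>bform_hess_one_pos\<close> it says that each Hessian has exactly one positive
  direction.\<close>

lemma hess_nonpos_on_orthogonal:
  assumes "S \<in> \<I>" "card S + 2 + n = r" "bform E (hess S) (\<lambda>_. 1) v = 0"
  shows "bform E (hess S) v v \<le> 0"
  using assms
proof (induction n arbitrary: S v)
  case 0
  let ?L = "nonloops S"
  have r: "card S + 2 \<le> r" "card S + 2 = r" using 0 by auto
  show ?case
  \<comment> \<open>It suffices to treat vectors whose sum over the nonloops is zero; for these the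
    all-ones part of the matrix drops out.\<close>
  proof (rule bform_nonpos_on_orthogonal[OF hess_sym _ _ "0.prems"(3)])
    show "0 < bform E (hess S) (\<lambda>_. 1) (\<lambda>_. 1)" using bform_hess_one_pos 0 r by blast
    fix v :: "'e \<Rightarrow> real" assume "(\<Sum>i\<in>E. (if i \<in> ?L then 1 else 0) * v i) = 0"
    also have "(\<Sum>i\<in>E. (if i \<in> ?L then 1 else 0) * v i) = (\<Sum>i\<in>?L. v i)"
      using finite_ground nonloops_subset by (intro sum.mono_neutral_cong_right) auto
    finally have v: "(\<Sum>i\<in>?L. v i) = 0" .
    have "bform E (hess S) v v = (\<Sum>i\<in>?L. v i * (\<Sum>j\<in>?L. hess S i j * v j))"
      unfolding bform_hess_restrict[OF "0.prems"(1) r(1)] unfolding bform_eq_sum_left ..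
    also have "\<dots> = (\<Sum>i\<in>?L. v i * (\<Sum>j\<in>?L. v j - (if spans (insert i S) j then v j else 0)))"
      using hess_corank_two[OF "0.prems"(1) r(2)] by (intro sum.cong refl arg_cong2[of _ _ _ _ "(*)"]) auto
    also have "\<dots> = - (\<Sum>i\<in>?L. (\<Sum>j | j \<in> ?L \<and> spans (insert i S) j. v j) * v i)"
      using v finite_nonloops
      by (simp add: sum_subtractf sum_negf sum.inter_filter mult.commute)
    also have "\<dots> \<le> 0"
      using sum_products_equiv_nonneg[where R = "\<lambda>i j. spans (insert i S) j",
        OF finite_nonloops spans_self parallel_cong[OF "0.prems"(1)], of S v] by simp
    finally show "bform E (hess S) v v \<le> 0" .
  qed
next
  case (Suc n)
  let ?L = "nonloops S" and ?one = "\<lambda>_. 1 :: real"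
  define q where "q = real r - card S - 2"
  define d where "d = (\<lambda>i. \<Sum>j\<in>?L. hess S i j)"
  have r: "card S + 2 \<le> r" and q: "q > 0" using Suc.prems by (auto simp: q_def)
  note S = Suc.prems(1)
  have SE: "S \<subseteq> E" using S indep_subset by blast
  note restrict = bform_hess_restrict[OF S r] sum_hess_restrict[OF S r]
  have sum1: "(\<Sum>j\<in>E. hess S i j) = d i" for i
    using restrict(2)[of i ?one] by (simp add: d_def)
  have gap: "bform ?L (hess S) w w \<le> (\<Sum>i\<in>?L. (\<Sum>j\<in>?L. hess S i j * w j)\<^sup>2 / d i)" for w
  proof -
    \<comment> \<open>The reversed Cauchy-Schwarz inequality against the all-ones vector, which the
      induction hypothesis supplies for the contraction by \<open>insert i S\<close>.\<close>
    have "bform E (hess (insert i S)) w w \<le> q * ((\<Sum>j\<in>?L. hess S i j * w j)\<^sup>2 / d i)" if i: "i \<in> ?L" for i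
    proof -
      have i': "i \<in> E" "i \<notin> S" "insert i S \<in> \<I>" using i by (auto simp: nonloops_def)
      have c: "card (insert i S) = Suc (card S)" using card_insert_nonloop i S by blast
      have "bform E (hess (insert i S)) w w * bform E (hess (insert i S)) ?one ?one
            \<le> (bform E (hess (insert i S)) ?one w)\<^sup>2"
        using i' c Suc.prems bform_hess_one_pos[of "insert i S"]
        by (intro reversed_Cauchy_Schwarz hess_sym Suc.IH) auto
      then have "bform E (hess (insert i S)) w w * (q * d i) \<le> (q * (\<Sum>j\<in>?L. hess S i j * w j))\<^sup>2"
        using bform_hess_insert_one[OF SE i'(1,2)] by (simp add: q_def sum1 restrict)
      moreover have "d i > 0" using hess_row_pos[OF S r i] by (simp add: d_def)
      ultimately show ?thesis using q by (simp add: power2_eq_square field_simps)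
    qed
    \<comment> \<open>Summed over \<open>i\<close>, the left-hand sides give \<open>q\<close> times
      the form of \<open>S\<close>; the common factor \<open>q > 0\<close> then cancels.\<close>
    then have "q * bform E (hess S) w w \<le> (\<Sum>i\<in>?L. q * ((\<Sum>j\<in>?L. hess S i j * w j)\<^sup>2 / d i))"
      unfolding q_def sum_bform_hess_insert[OF SE, symmetric] by (intro sum_mono) (auto simp: q_def)
    then show ?thesis
      using q unfolding sum_distrib_left[symmetric] restrict(1) by (simp only: mult_le_cancel_left_pos)
  qed
  have "bform ?L (hess S) v v \<le> 0"
  proof (rule bform_nonpos_of_gap[OF finite_nonloops hess_sym hess_nonneg])
    show "0 < (\<Sum>j\<in>?L. hess S i j)" if "i \<in> ?L" for i
      using hess_row_pos[OF S r that] .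
    show "0 < hess S i j \<or> (\<exists>k\<in>?L. 0 < hess S i k \<and> 0 < hess S k j)"
      if ij: "i \<in> ?L" "j \<in> ?L" for i j
    proof (cases "spans (insert i S) j")
      case True
      \<comment> \<open>Parallel elements have a common neighbour, namely any nonloop outside their
        class.\<close>
      obtain k where k: "k \<in> ?L" "\<not> spans (insert i S) k"
        using nonparallel_exists[OF S r ij(1)] by blast
      have "\<not> spans (insert j S) k" using parallel_cong[OF S ij True] k by simp
      then have "0 < hess S j k" using hess_pos_iff[OF S r] ij k by blast
      moreover have "0 < hess S i k" using hess_pos_iff[OF S r] ij k by blast
      ultimately show ?thesis using k hess_sym[of S j k] by auto
    qed (use hess_pos_iff[OF S r] ij in auto)
    show "bform ?L (hess S) w w \<le> (\<Sum>i\<in>?L. (\<Sum>j\<in>?L. hess S i j * w j)\<^sup>2 / (\<Sum>j\<in>?L. hess S i j))" for w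
      using gap[of w] by (simp add: d_def)
    have "bform E (hess S) v ?one = 0"
      using Suc.prems(3) by (subst bform_commute[OF hess_sym])
    then show "(\<Sum>i\<in>?L. (\<Sum>j\<in>?L. hess S i j) * v i) = 0"
      unfolding restrict(1) unfolding bform_eq_sum_left by (simp add: mult.commute)
  qed
  then show ?case by (simp add: restrict)
qed

section \<open>Kernels of the Hessians\<close>

text \<open>By Euler's identity a kernel vector is orthogonal to the all-ones vector for every
  \<open>hess (insert i S)\<close>, so its values there are nonpositive. They sum to a multiple of
  its value for \<open>hess S\<close>, which is zero. Hence each vanishes, and
  \<open>bform_null_vector\<close> applies.\<close>

lemma hess_kernel_insert:
  assumes S: "S \<in> \<I>" "card S + 3 \<le> r"
    and ker: "\<And>i. i \<in> E \<Longrightarrow> (\<Sum>j\<in>E. hess S i j * v j) = 0"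
    and i: "i \<in> nonloops S" and k: "k \<in> E"
  shows "(\<Sum>j\<in>E. hess (insert i S) k j * v j) = 0"
proof -
  have SE: "S \<subseteq> E" using S indep_subset by blast
  have one: "bform E (hess (insert i S)) (\<lambda>_. 1) v = 0" if "i \<in> nonloops S" for i
    using bform_hess_insert_one[OF SE, of i v] that ker by (simp add: nonloops_def)
  have neg: "bform E (hess (insert i S)) w w \<le> 0"
    if "i \<in> nonloops S" "bform E (hess (insert i S)) (\<lambda>_. 1) w = 0" for i w
    using that S card_insert_nonloop[of i S]
    by (intro hess_nonpos_on_orthogonal[of "insert i S" "r - card S - 3"]) (auto simp: nonloops_def)
  have "bform E (hess S) v v = 0" using ker by (simp add: bform_eq_sum_left)
  then have "(\<Sum>i\<in>nonloops S. - bform E (hess (insert i S)) v v) = 0"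
    by (simp add: sum_negf sum_bform_hess_insert[OF SE])
  then have null: "bform E (hess (insert i S)) v v = 0"
    using i neg[OF _ one] finite_nonloops by (subst (asm) sum_nonneg_eq_0_iff) auto
  have null_k: "bform E (hess (insert i S)) v (\<lambda>j. if j = k then 1 else 0) = 0"
  proof (rule bform_null_vector[OF hess_sym neg[OF i] _ one[OF i] null])
    show "0 < bform E (hess (insert i S)) (\<lambda>_. 1) (\<lambda>_. 1)"
      using i S card_insert_nonloop[of i S]
      by (intro bform_hess_one_pos) (auto simp: nonloops_def)
  qed
  show ?thesis
    unfolding bform_indicator[OF finite_ground k, symmetric]
    by (subst bform_commute[OF hess_sym]) (rule null_k)
qed

text \<open>Induction on the corank. In corank two, row \<open>i\<close> of the kernel equation says
  that the class sum of \<open>i\<close> equals the total. In higher corank the same is shown inside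
  a line through \<open>i\<close>, by contracting its points. Either way at least two classes share
  the common sum, which is therefore zero.\<close>

lemma hess_kernel_class_sum:
  assumes "S \<in> \<I>" "card S + 2 + n = r"
    and "\<And>i. i \<in> E \<Longrightarrow> (\<Sum>j\<in>E. hess S i j * v j) = 0"
    and "i \<in> nonloops S"
  shows "(\<Sum>j | j \<in> nonloops S \<and> spans (insert i S) j. v j) = 0"
  using assms
proof (induction n arbitrary: S i)
  case 0
  let ?L = "nonloops S"
  have r: "card S + 2 \<le> r" "card S + 2 = r" using 0 by auto
  have total: "(\<Sum>j | j \<in> ?L \<and> spans (insert i S) j. v j) = (\<Sum>j\<in>?L. v j)" if i: "i \<in> ?L" for i
  proof -
    have "0 = (\<Sum>j\<in>?L. hess S i j * v j)"
      using "0.prems"(3)[of i] sum_hess_restrict[OF "0.prems"(1) r(1), of i v] i nonloops_subset by auto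
    also have "\<dots> = (\<Sum>j\<in>?L. v j - (if spans (insert i S) j then v j else 0))"
      using hess_corank_two[OF "0.prems"(1) r(2) i] by (intro sum.cong) auto
    finally show ?thesis using finite_nonloops by (simp add: sum_subtractf sum.inter_filter)
  qed
  obtain a b where "a \<in> ?L" "b \<in> ?L" "\<not> spans (insert a S) b"
    using two_nonparallel[OF "0.prems"(1) r(1)] by blast
  then have "(\<Sum>j\<in>?L. v j) = 0"
    by (intro sum_zero_if_class_sums_total[where R = "\<lambda>i j. spans (insert i S) j"]
        finite_nonloops spans_self parallel_cong[OF "0.prems"(1)] total)
  then show ?case using total[OF "0.prems"(4)] by simp
next
  case (Suc n)
  note S = Suc.prems(1) and i = Suc.prems(4)
  let ?L = "nonloops S"
  have r: "card S + 2 \<le> r" "card S + 3 \<le> r" using Suc.prems by auto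
  obtain k where k: "k \<in> ?L" "\<not> spans (insert i S) k"
    using nonparallel_exists[OF S r(1) i] by blast
  let ?T = "insert k (insert i S)"
  \<comment> \<open>The nonloops on the line of the contraction through \<open>i\<close> and
    \<open>k\<close>; a union of parallel classes.\<close>
  define M where "M = {j \<in> ?L. spans ?T j}"
  have T: "?T \<in> \<I>" "card ?T = card S + 2"
    using k i S indep_finite[OF S] by (auto simp: spans_def nonloops_def)
  have total: "(\<Sum>j | j \<in> M \<and> spans (insert m S) j. v j) = (\<Sum>j\<in>M. v j)"
    and sub: "\<And>j. j \<in> ?L \<Longrightarrow> spans (insert m S) j \<Longrightarrow> j \<in> M" if m: "m \<in> M" for m
  proof -
    have mL: "m \<in> ?L" using m by (simp add: M_def)
    \<comment> \<open>The line \<open>M\<close> is also spanned by \<open>m\<close> and one of \<open>i\<close>, \<open>k\<close>.\<close>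
    obtain k' where k': "k' \<in> ?L" "k' \<in> {i, k}" "\<not> spans (insert m S) k'"
      using parallel_cong[OF S mL i, of k] i k
      by (cases "spans (insert m S) i") auto
    let ?T' = "insert k' (insert m S)"
    have T': "?T' \<in> \<I>" "card ?T' = card S + 2"
      using k' mL S indep_finite[OF S] by (auto simp: spans_def nonloops_def)
    have span: "spans ?T j = spans ?T' j" for j
    proof (rule spans_cong[OF T(1) T'(1)])
      show "spans ?T x" if "x \<in> ?T'" for x
        using that k' m by (auto simp: M_def spans_def)
    qed (simp only: T T')
    show sub: "j \<in> M" if "j \<in> ?L" "spans (insert m S) j" for j
    proof -
      have "spans ?T' j" using that(2) by (rule spans_mono) auto
      then show ?thesis using that(1) span by (simp add: M_def)
    qed
    \<comment> \<open>Contracting by \<open>m\<close> turns the rest of the line into one parallel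
      class, whose sum vanishes by induction. So the class of \<open>m\<close> carries the whole sum
      over \<open>M\<close>.\<close>
    have "(\<Sum>j | j \<in> nonloops (insert m S) \<and> spans ?T' j. v j) = 0"
    proof (rule Suc.IH)
      show "insert m S \<in> \<I>" using mL by (simp add: nonloops_def)
      show "card (insert m S) + 2 + n = r"
        using Suc.prems(2) card_insert_nonloop[OF mL S] by simp
      show "(\<Sum>j\<in>E. hess (insert m S) i j * v j) = 0" if "i \<in> E" for i
        using hess_kernel_insert[OF S r(2) Suc.prems(3) mL that] .
      show "k' \<in> nonloops (insert m S)" using k' by (simp add: nonloops_insert[OF S mL])
    qed
    also have "{j. j \<in> nonloops (insert m S) \<and> spans ?T' j} = M - {j \<in> M. spans (insert m S) j}"
      by (auto simp: nonloops_insert[OF S mL] M_def span)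
    finally show "(\<Sum>j | j \<in> M \<and> spans (insert m S) j. v j) = (\<Sum>j\<in>M. v j)"
      using finite_nonloops by (subst (asm) sum_diff) (auto simp: M_def)
  qed
  have iM: "i \<in> M" and kM: "k \<in> M" using i k by (auto simp: M_def spans_def)
  have "(\<Sum>j\<in>M. v j) = 0"
  proof (rule sum_zero_if_class_sums_total[where R = "\<lambda>i j. spans (insert i S) j", OF _ _ _ total iM kM k(2)])
    show "finite M" using finite_nonloops by (simp add: M_def)
    show "spans (insert a S) c = spans (insert b S) c"
      if "a \<in> M" "b \<in> M" "spans (insert a S) b" for a b c
      using that by (intro parallel_cong[OF S]) (auto simp: M_def)
  qed (auto simp: spans_self)
  moreover have "{j. j \<in> ?L \<and> spans (insert i S) j} = {j. j \<in> M \<and> spans (insert i S) j}"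
    using sub[OF iM] by (auto simp: M_def)
  ultimately show ?case using total[OF iM] by simp
qed

text \<open>In a simple matroid the parallel classes are singletons, so the class sums are the
  entries of \<open>v\<close>. The case \<open>i = j\<close> of \<open>simple\<close> excludes
  loops.\<close>

lemma hess_kernel_trivial:
  assumes r: "2 \<le> r" and simple: "\<And>i j. i \<in> E \<Longrightarrow> j \<in> E \<Longrightarrow> {i, j} \<in> \<I>"
    and ker: "\<And>i. i \<in> E \<Longrightarrow> (\<Sum>j\<in>E. hess {} i j * v j) = 0"
    and i: "i \<in> E"
  shows "v i = 0"
proof -
  have empty: "{} \<in> \<I>" using rank_ge hereditary by blast
  have "{j} \<in> \<I>" if "j \<in> E" for j using simple[OF that that] by simp
  then have "nonloops {} = E" by (auto simp: nonloops_def)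
  moreover have "{j. j \<in> E \<and> spans {i} j} = {i}"
    using i simple[OF _ i] by (auto simp: spans_def)
  moreover have "(\<Sum>j | j \<in> nonloops {} \<and> spans {i} j. v j) = 0"
  proof (rule hess_kernel_class_sum[where n = "r - 2", OF empty])
    show "card {} + 2 + (r - 2) = r" using r by simp
    show "i \<in> nonloops {}" using i calculation(1) by simp
  qed (rule ker)
  ultimately show ?thesis by simp
qed

end

section \<open>Eigenvalues of symmetric matrices\<close>

text \<open>The matrix determinant lemma, from Sylvester's identity for a column \<open>B\<close>
  and a row \<open>C\<close>: one block matrix is written in two ways as a product of block
  triangular factors.\<close>

lemma det_one_plus_rank_one:
  fixes u v :: "nat \<Rightarrow> 'a :: field"
  shows "det (mat n n (\<lambda>(i, j). (if i = j then 1 else 0) + u i * v j)) = 1 + (\<Sum>i<n. u i * v i)"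
proof -
  define B where "B = mat n 1 (\<lambda>(i, _). u i)"
  define C where "C = mat 1 n (\<lambda>(_, j). v j)"
  have B: "B \<in> carrier_mat n 1" and C: "C \<in> carrier_mat 1 n" by (auto simp: B_def C_def)
  let ?I = "1\<^sub>m n :: 'a mat" and ?J = "1\<^sub>m 1 :: 'a mat"
  have BC: "B * C \<in> carrier_mat n n" and CB: "C * B \<in> carrier_mat 1 1" using B C by auto
  have C_distrib: "C * (?I + B * C) = C + C * (B * C)"
    using mult_add_distrib_mat[OF C _ BC, of ?I] right_mult_one_mat[OF C] by simp
  have distrib_C: "(C * B + ?J) * C = C + C * (B * C)"
    using add_mult_distrib_mat[OF CB _ C, of ?J] left_mult_one_mat[OF C] assoc_mult_mat[OF C B C]
      comm_add_mat[OF C, of "C * (B * C)"] C BC by simp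
  have "det (four_block_mat ?I (0\<^sub>m n 1) C ?J * four_block_mat (?I + B * C) B (0\<^sub>m 1 n) ?J) =
        det (four_block_mat ?I B (0\<^sub>m 1 n) (C * B + ?J) * four_block_mat ?I (0\<^sub>m n 1) C ?J)"
  proof (rule arg_cong[of _ _ det])
    have "four_block_mat ?I (0\<^sub>m n 1) C ?J * four_block_mat (?I + B * C) B (0\<^sub>m 1 n) ?J =
        four_block_mat (?I + B * C) B (C + C * (B * C)) (C * B + ?J)"
      using B C BC
      by (subst mult_four_block_mat[of _ n n _ 1 _ 1 _ _ n _ 1])
        (auto simp: C_distrib)
    moreover have "four_block_mat ?I B (0\<^sub>m 1 n) (C * B + ?J) * four_block_mat ?I (0\<^sub>m n 1) C ?J =
        four_block_mat (?I + B * C) B (C + C * (B * C)) (C * B + ?J)"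
      using B C CB
      by (subst mult_four_block_mat[of _ n n _ 1 _ 1 _ _ n _ 1])
        (auto simp: distrib_C[simplified] left_add_zero_mat[of _ 1 n, simplified])
    ultimately show "four_block_mat ?I (0\<^sub>m n 1) C ?J * four_block_mat (?I + B * C) B (0\<^sub>m 1 n) ?J =
      four_block_mat ?I B (0\<^sub>m 1 n) (C * B + ?J) * four_block_mat ?I (0\<^sub>m n 1) C ?J" by simp
  qed
  then have "det (?I + B * C) = det (C * B + ?J)"
    using B C BC CB
    by (subst (asm) (1 2) det_mult[of _ "n + 1"])
      (auto simp: det_four_block_mat_upper_right_zero[of _ n _ 1]
        det_four_block_mat_lower_left_zero[of _ n _ 1])
  also have "\<dots> = 1 + (\<Sum>i<n. u i * v i)"
    using B C by (subst det_single) (auto simp: scalar_prod_def B_def C_def atLeast0LessThan mult.commute)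
  also have "?I + B * C = mat n n (\<lambda>(i, j). (if i = j then 1 else 0) + u i * v j)"
    by (rule eq_matI) (auto simp: B_def C_def scalar_prod_def)
  finally show ?thesis .
qed

lemma poly_char_poly_mat:
  fixes h :: "nat \<Rightarrow> nat \<Rightarrow> 'a :: field"
  shows "poly (char_poly (mat n n (\<lambda>(i, j). h i j))) t =
         det (mat n n (\<lambda>(i, j). (if i = j then t else 0) - h i j))"
proof -
  have "- char_matrix (mat n n (\<lambda>(i, j). h i j)) t = mat n n (\<lambda>(i, j). (if i = j then t else 0) - h i j)"
    by (rule eq_matI) (auto simp: char_matrix_def)
  then show ?thesis by (simp add: char_poly_matrix[of _ n])
qed

lemma det_mat_eq_0_iff:
  fixes h :: "nat \<Rightarrow> nat \<Rightarrow> 'a :: field"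
  shows "det (mat n n (\<lambda>(i, j). h i j)) = 0 \<longleftrightarrow>
    (\<exists>x. (\<exists>i<n. x i \<noteq> 0) \<and> (\<forall>i<n. (\<Sum>j<n. h i j * x j) = 0))" (is "?l = ?r")
proof -
  have mult: "mat n n (\<lambda>(i, j). h i j) *\<^sub>v vec n x = 0\<^sub>v n \<longleftrightarrow> (\<forall>i<n. (\<Sum>j<n. h i j * x j) = 0)" for x
    by (auto simp: vec_eq_iff scalar_prod_def atLeast0LessThan)
  have nz: "vec n x \<noteq> 0\<^sub>v n \<longleftrightarrow> (\<exists>i<n. x i \<noteq> 0)" for x :: "nat \<Rightarrow> 'a"
    by (auto simp: vec_eq_iff)
  have "?l \<longleftrightarrow> (\<exists>v. v \<in> carrier_vec n \<and> v \<noteq> 0\<^sub>v n \<and> mat n n (\<lambda>(i, j). h i j) *\<^sub>v v = 0\<^sub>v n)"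
    by (rule det_0_iff_vec_prod_zero_field) simp
  also have "\<dots> \<longleftrightarrow> (\<exists>x. vec n x \<noteq> 0\<^sub>v n \<and> mat n n (\<lambda>(i, j). h i j) *\<^sub>v vec n x = 0\<^sub>v n)"
    by (metis vec_carrier carrier_vecD eq_vecI dim_vec index_vec)
  finally show ?thesis unfolding mult nz .
qed

lemma sum_delta_mult:
  fixes f :: "nat \<Rightarrow> 'a :: semiring_1"
  shows "i < n \<Longrightarrow> (\<Sum>j<n. (if i = j then t else 0) * f j) = t * f i"
  by (simp add: mult_delta_left)

text \<open>Deflation: subtracting \<open>l + 1\<close> times the projection onto the unit
  eigenvector \<open>v\<close> moves its eigenvalue from \<open>l\<close> to -1. The polynomials
  agree at all \<open>t \<ge> 0\<close>, where \<open>t + 1\<close> is invertible, hence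
  everywhere.\<close>

lemma char_poly_deflate:
  fixes h :: "nat \<Rightarrow> nat \<Rightarrow> real"
  assumes eig: "\<And>i. i < n \<Longrightarrow> (\<Sum>j<n. h i j * v j) = l * v i"
    and unit: "(\<Sum>i<n. v i * v i) = 1"
  shows "[:1, 1:] * char_poly (mat n n (\<lambda>(i, j). h i j)) =
         [:- l, 1:] * char_poly (mat n n (\<lambda>(i, j). h i j - (l + 1) * v i * v j))" (is "?p = ?q")
proof (rule ccontr)
  define g where "g = (\<lambda>i j. h i j - (l + 1) * v i * v j)"
  assume "?p \<noteq> ?q"
  then have "finite {t. poly (?p - ?q) t = 0}" by (intro poly_roots_finite) simp
  moreover have "poly ?p t = poly ?q t" if t: "t \<ge> 0" for t
  proof -
    \<comment> \<open>As \<open>v\<close> has eigenvalue -1 for \<open>g\<close>, the factor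
      \<open>?R\<close> changes \<open>?G\<close> by \<open>c * (t + 1)\<close> times the
      projection, which this \<open>c\<close> makes \<open>l + 1\<close>. Its determinant is
      \<open>1 - c\<close>.\<close>
    define c where "c = (l + 1) / (t + 1)"
    have gv: "(\<Sum>k<n. g i k * v k) = - v i" if "i < n" for i
    proof -
      have "(\<Sum>k<n. g i k * v k) = (\<Sum>k<n. h i k * v k) - (l + 1) * v i * (\<Sum>k<n. v k * v k)"
        by (simp add: g_def algebra_simps sum_subtractf sum_distrib_left sum.distrib)
      then show ?thesis using eig[OF that] unit by (simp add: algebra_simps)
    qed
    let ?G = "mat n n (\<lambda>(i, j). (if i = j then t else 0) - g i j)"
    let ?R = "mat n n (\<lambda>(i, j). (if i = j then 1 else 0) + (- c * v i) * v j)"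
    have "mat n n (\<lambda>(i, j). (if i = j then t else 0) - h i j) = ?G * ?R"
    proof (rule eq_matI)
      fix i j assume "i < dim_row (?G * ?R)" "j < dim_col (?G * ?R)"
      then have ij: "i < n" "j < n" by auto
      have "(?G * ?R) $$ (i, j) =
        (\<Sum>k<n. ((if i = k then t else 0) - g i k) * ((if k = j then 1 else 0) + (- c * v k) * v j))"
        using ij by (simp add: scalar_prod_def atLeast0LessThan)
      also have "\<dots> = (\<Sum>k<n. (if j = k then 1 else 0) * ((if i = k then t else 0) - g i k))
          - c * v j * (\<Sum>k<n. ((if i = k then t else 0) - g i k) * v k)"
        unfolding sum_distrib_left sum_subtractf[symmetric]
        by (intro sum.cong refl) (auto simp: algebra_simps)
      also have "(\<Sum>k<n. ((if i = k then t else 0) - g i k) * v k) = t * v i + v i"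
        using ij unfolding left_diff_distrib sum_subtractf by (simp add: sum_delta_mult gv)
      also have "(\<Sum>k<n. (if j = k then 1 else 0) * ((if i = k then t else 0) - g i k)) - c * v j * (t * v i + v i)
          = (if i = j then t else 0) - g i j - c * (t + 1) * v i * v j"
        using ij(2) by (subst sum_delta_mult) (simp_all add: algebra_simps)
      also have "c * (t + 1) = l + 1" using t by (simp add: c_def)
      finally show "mat n n (\<lambda>(i, j). (if i = j then t else 0) - h i j) $$ (i, j) = (?G * ?R) $$ (i, j)"
        using ij by (simp add: g_def)
    qed auto
    then have "poly (char_poly (mat n n (\<lambda>(i, j). h i j))) t =
        poly (char_poly (mat n n (\<lambda>(i, j). g i j))) t * det ?R"
      unfolding poly_char_poly_mat by (simp add: det_mult[of _ n])
    also have "det ?R = 1 - c"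
      unfolding det_one_plus_rank_one using unit by (simp add: mult.assoc sum_negf flip: sum_distrib_left)
    finally show ?thesis using t by (simp add: c_def g_def field_simps)
  qed
  then have "{0..} \<subseteq> {t. poly (?p - ?q) t = 0}" by auto
  ultimately show False using infinite_Ici[of "0::real"] finite_subset by blast
qed

text \<open>To control algebraic multiplicity, the largest eigenvalue \<open>l\<close> is deflated
  to -1. The deflated matrix has no eigenvalue \<open>t \<ge> 0\<close>, so \<open>l\<close> is a
  simple root and the only positive one.\<close>

lemma num_pos_eigenvalues_eq_1:
  fixes h :: "nat \<Rightarrow> nat \<Rightarrow> real"
  defines "A n \<equiv> mat n n (\<lambda>(i, j). h i j)"
  assumes sym: "\<And>i j. h i j = h j i"
    and inj: "\<And>x i. (\<And>i. i < n \<Longrightarrow> (\<Sum>j<n. h i j * x j) = 0) \<Longrightarrow> i < n \<Longrightarrow> x i = 0"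
    and pos: "0 < bform {..<n} h u u"
    and neg: "\<And>w. bform {..<n} h u w = 0 \<Longrightarrow> bform {..<n} h w w \<le> 0"
  shows "num_pos_eigenvalues (A n) = 1"
proof -
  let ?L = "{..<n}"
  obtain i0 where i0: "i0 \<in> ?L" "u i0 \<noteq> 0"
    using pos that by (cases "\<forall>i\<in>?L. u i = 0") (auto simp: bform_def)
  \<comment> \<open>Unit weights and the zero constraint give the ordinary unconstrained Rayleigh
    maximizer.\<close>
  obtain v l where v1: "(\<Sum>i<n. (v i)\<^sup>2) = 1"
    and le: "\<And>w. bform ?L h w w \<le> l * (\<Sum>i<n. (w i)\<^sup>2)"
    and eq: "\<And>w. bform ?L h v w = l * (\<Sum>i<n. v i * w i)"
    using constrained_Rayleigh_maximizer[where h = h and d = "\<lambda>_. 1" and a = "\<lambda>_. 0" and ?v0.0 = u and ?i0.0 = i0 and L = ?L,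
        OF _ sym _ _ i0]
    by auto
  have unit: "(\<Sum>i<n. v i * v i) = 1" using v1 by (simp add: power2_eq_square)
  have l: "l > 0"
  proof -
    have "0 < l * (\<Sum>i<n. (u i)\<^sup>2)" using le[of u] pos by linarith
    then show ?thesis by (simp add: zero_less_mult_iff sum_nonneg leD)
  qed
  have vv: "bform ?L h v v = l" using eq[of v] unit by simp
  have eig: "(\<Sum>j<n. h i j * v j) = l * v i" if "i < n" for i
  proof -
    have "(\<Sum>j<n. h i j * v j) = bform ?L h (\<lambda>j. if j = i then 1 else 0) v"
      using that by (subst bform_indicator) auto
    also have "\<dots> = bform ?L h v (\<lambda>j. if j = i then 1 else 0)"
      by (rule bform_commute[OF sym])
    also have "\<dots> = l * v i"
      using that by (simp add: eq mult_delta_right)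
    finally show ?thesis .
  qed
  have negv: "bform ?L h w w \<le> 0" if w: "bform ?L h v w = 0" for w
  proof (rule bform_nonpos_on_orthogonal[OF sym _ _ w])
    show "0 < bform ?L h v v" using vv l by simp
    fix x assume "(\<Sum>j<n. (\<Sum>i<n. h i j * u i) * x j) = 0"
    moreover have "(\<Sum>j<n. (\<Sum>i<n. h i j * u i) * x j) = bform ?L h u x"
      unfolding bform_def sum_distrib_right by (rule sum.swap)
    ultimately show "bform ?L h x x \<le> 0" using neg by simp
  qed
  define g where "g = (\<lambda>i j. h i j - (l + 1) * v i * v j)"
  have no_root: "poly (char_poly (mat n n (\<lambda>(i, j). g i j))) t \<noteq> 0" if t: "t \<ge> 0" for t
  proof
    assume "poly (char_poly (mat n n (\<lambda>(i, j). g i j))) t = 0"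
    then obtain x i1 where x: "i1 < n" "x i1 \<noteq> 0"
      and ker: "\<And>i. i < n \<Longrightarrow> (\<Sum>j<n. ((if i = j then t else 0) - g i j) * x j) = 0"
      unfolding poly_char_poly_mat det_mat_eq_0_iff by blast
    define \<alpha> where "\<alpha> = (\<Sum>i<n. v i * x i)"
    \<comment> \<open>The component of the supposed eigenvector \<open>x\<close> orthogonal to
      \<open>v\<close>. Its value is \<open>t\<close> times the squared norm of \<open>x\<close>
      plus \<open>\<alpha>\<close> squared, yet nonpositive; so \<alpha> = 0 and \<open>x\<close>
      itself lies in the kernel of \<open>h\<close>.\<close>
    define y where "y = (\<lambda>i. x i + (- \<alpha>) * v i)"
    have gx: "(\<Sum>j<n. g i j * x j) = t * x i" if "i < n" for i
      using ker[OF that] that by (simp add: left_diff_distrib sum_subtractf sum_delta_mult)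
    have gh: "(\<Sum>j<n. g i j * x j) = (\<Sum>j<n. h i j * x j) - (l + 1) * \<alpha> * v i" for i
      by (simp add: g_def \<alpha>_def algebra_simps sum_subtractf sum_distrib_left sum.distrib)
    have hx: "(\<Sum>j<n. h i j * x j) = t * x i + (l + 1) * \<alpha> * v i" if "i < n" for i
      using gx[OF that] gh[of i] by linarith
    have "bform ?L h x x = (\<Sum>i<n. x i * (t * x i + (l + 1) * \<alpha> * v i))"
      unfolding bform_eq_sum_left by (intro sum.cong refl) (simp add: hx)
    also have "\<dots> = t * (\<Sum>i<n. (x i)\<^sup>2) + (l + 1) * \<alpha> * \<alpha>"
      by (simp add: \<alpha>_def algebra_simps sum.distrib sum_distrib_left power2_eq_square)
    finally have xx: "bform ?L h x x = t * (\<Sum>i<n. (x i)\<^sup>2) + (l + 1) * \<alpha> * \<alpha>" .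
    have vx: "bform ?L h v x = l * \<alpha>" by (simp add: eq \<alpha>_def)
    have vy: "bform ?L h v y = 0"
      unfolding y_def bform_add_right bform_scale_right vx vv by simp
    have xv: "bform ?L h x v = l * \<alpha>" unfolding vx[symmetric] by (rule bform_commute[OF sym])
    have "bform ?L h y y = bform ?L h x x - l * \<alpha> * \<alpha>"
      unfolding y_def bform_add_scale[OF sym] xv vv by (simp add: power2_eq_square algebra_simps)
    then have yy: "bform ?L h y y = t * (\<Sum>i<n. (x i)\<^sup>2) + \<alpha> * \<alpha>"
      using xx by (simp add: algebra_simps)
    moreover have "t * (\<Sum>i<n. (x i)\<^sup>2) \<ge> 0" using t by (simp add: sum_nonneg)
    ultimately have "\<alpha> * \<alpha> \<le> 0" "bform ?L h y y = 0"
      using negv[OF vy] zero_le_square[of \<alpha>] by linarith+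
    then have \<alpha>: "\<alpha> = 0" by (auto simp: mult_le_0_iff)
    have "(\<Sum>j<n. h i j * y j) = 0" if "i < n" for i
    proof -
      have "bform ?L h y (\<lambda>j. if j = i then 1 else 0) = 0"
        using bform_null_vector[OF sym negv _ vy \<open>bform ?L h y y = 0\<close>] vv l by simp
      then have "bform ?L h (\<lambda>j. if j = i then 1 else 0) y = 0"
        by (subst bform_commute[OF sym])
      then show ?thesis using that by (subst (asm) bform_indicator) auto
    qed
    then have "y i1 = 0" using x(1) by (rule inj)
    then show False using x(2) \<alpha> by (simp add: y_def)
  qed
  let ?p = "char_poly (A n)" and ?q = "char_poly (mat n n (\<lambda>(i, j). g i j))"
  have pq: "[:1, 1:] * ?p = [:- l, 1:] * ?q"
    unfolding A_def g_def by (rule char_poly_deflate[OF eig unit])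
  have A: "A n \<in> carrier_mat n n" by (simp add: A_def)
  have root: "poly ?p c = 0 \<longleftrightarrow> c = l" if "c > 0" for c
  proof -
    have "(1 + c) * poly ?p c = (c - l) * poly ?q c"
      using arg_cong[OF pq, of "\<lambda>p. poly p c"] by (simp add: algebra_simps)
    then show ?thesis using no_root[of c] that
      by (metis add_pos_pos eq_iff_diff_eq_0 less_imp_le less_numeral_extra(1) less_numeral_extra(3) mult_eq_0_iff)
  qed
  have nz: "?p \<noteq> 0" "?q \<noteq> 0" using degree_monic_char_poly[OF A] no_root[of 0] by auto
  have "order l [:1, 1:] = 0" "order l ?q = 0"
    using l no_root[of l] by (auto intro!: order_0I)
  moreover have "order l [:- l, 1:] = 1" using order_power_n_n[of l 1] by simp
  moreover have "order l ([:1, 1:] * ?p) = order l ([:- l, 1:] * ?q)" by (simp only: pq)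
  moreover have nz': "[:1, 1:] * ?p \<noteq> 0" "[:- l, 1:] * ?q \<noteq> 0"
    using nz by (simp_all only: mult_eq_0_iff) simp_all
  ultimately have "order l ?p = 1"
    using order_mult[OF nz'(1), of l] order_mult[OF nz'(2), of l] by linarith
  moreover have "{c. eigenvalue (A n) c \<and> 0 < c} = {l}"
    using root l by (auto simp: eigenvalue_root_char_poly[OF A])
  ultimately show ?thesis by (simp add: num_pos_eigenvalues_def)
qed

section \<open>Forests\<close>

text \<open>Reachability as in \<open>connected_rel\<close>, without the restriction to a vertex
  set, so that edge sets can be treated alone.\<close>

definition walk_rel :: "'a set set \<Rightarrow> ('a \<times> 'a) set" where
  "walk_rel F = {(a, b). {a, b} \<in> F}\<^sup>*"

definition has_cycle :: "'a set set \<Rightarrow> bool" where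
  "has_cycle F \<longleftrightarrow> (\<exists>vs. graph_cycle (UNIV, F) vs)"

lemma has_cycle_iff: "has_cycle F \<longleftrightarrow> (\<exists>vs. graph_cycle (V, F) vs)"
  by (simp add: has_cycle_def graph_cycle_def)

lemma has_cycle_mono: "has_cycle F \<Longrightarrow> F \<subseteq> G \<Longrightarrow> has_cycle G"
  unfolding has_cycle_def graph_cycle_def by auto

lemma walk_rel_refl [simp]: "(a, a) \<in> walk_rel F"
  by (simp add: walk_rel_def)

lemma walk_rel_edge: "{a, b} \<in> F \<Longrightarrow> (a, b) \<in> walk_rel F"
  by (auto simp: walk_rel_def)

lemma walk_rel_trans: "(a, b) \<in> walk_rel F \<Longrightarrow> (b, c) \<in> walk_rel F \<Longrightarrow> (a, c) \<in> walk_rel F"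
  unfolding walk_rel_def by (rule rtrancl_trans)

lemma walk_rel_sym: "(a, b) \<in> walk_rel F \<Longrightarrow> (b, a) \<in> walk_rel F"
proof -
  have "sym {(a, b). {a, b} \<in> F}" by (auto simp: sym_def insert_commute)
  then show "(a, b) \<in> walk_rel F \<Longrightarrow> (b, a) \<in> walk_rel F"
    unfolding walk_rel_def by (meson sym_rtrancl symD)
qed

text \<open>A walk can be shortened to cross the new edge at most once, in one of its two
  directions.\<close>

lemma walk_rel_insert:
  "(u, v) \<in> walk_rel (insert {a, b} F) \<longleftrightarrow>
     (u, v) \<in> walk_rel F \<or> (u, a) \<in> walk_rel F \<and> (b, v) \<in> walk_rel F \<or>
     (u, b) \<in> walk_rel F \<and> (a, v) \<in> walk_rel F"
proof -
  have "{(x, y). {x, y} \<in> insert {a, b} F} = insert (a, b) (insert (b, a) {(x, y). {x, y} \<in> F})"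
    by (auto simp: doubleton_eq_iff)
  then have "(u, v) \<in> walk_rel (insert {a, b} F) \<longleftrightarrow>
    (u, v) \<in> walk_rel F \<or> (u, b) \<in> walk_rel F \<and> (a, v) \<in> walk_rel F \<or>
    ((u, a) \<in> walk_rel F \<or> (u, b) \<in> walk_rel F \<and> (a, a) \<in> walk_rel F) \<and>
    ((b, v) \<in> walk_rel F \<or> (b, b) \<in> walk_rel F \<and> (a, v) \<in> walk_rel F)"
    unfolding walk_rel_def by (simp only: rtrancl_insert) auto
  then show ?thesis using walk_rel_trans by (auto intro: walk_rel_trans)
qed

text \<open>The path grows with the walk; when the walk returns to a vertex of the path, the path is
  cut back to that vertex.\<close>

lemma walk_rel_imp_path:
  assumes "(a, b) \<in> walk_rel F"
  obtains vs where "vs \<noteq> []" "hd vs = a" "last vs = b" "distinct vs" "successively (\<lambda>x y. {x, y} \<in> F) vs"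
proof -
  from assms have "\<exists>vs. vs \<noteq> [] \<and> hd vs = a \<and> last vs = b \<and> distinct vs \<and> successively (\<lambda>x y. {x, y} \<in> F) vs"
    unfolding walk_rel_def
  proof (induction rule: rtrancl_induct)
    case base
    show ?case by (intro exI[of _ "[a]"]) simp
  next
    case (step b c)
    then obtain vs where vs: "vs \<noteq> []" "hd vs = a" "last vs = b" "distinct vs"
      "successively (\<lambda>x y. {x, y} \<in> F) vs" by blast
    show ?case
    proof (cases "c \<in> set vs")
      case True
      then obtain xs ys where "vs = xs @ c # ys" by (meson split_list)
      with vs show ?thesis
        by (intro exI[of _ "xs @ [c]"]) (auto simp: successively_append_iff hd_append)
    next
      case False
      with vs step show ?thesis
        by (intro exI[of _ "vs @ [c]"]) (auto simp: successively_append_iff)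
    qed
  qed
  then show ?thesis using that by blast
qed

text \<open>The new edge closes a path from \<open>a\<close> to \<open>b\<close>. That path has at
  least three vertices because \<open>{a, b}\<close> is not in \<open>F\<close>.\<close>

lemma has_cycle_insert_if_walk:
  assumes "(a, b) \<in> walk_rel F" "a \<noteq> b" "{a, b} \<notin> F"
  shows "has_cycle (insert {a, b} F)"
proof -
  obtain vs where vs: "vs \<noteq> []" "hd vs = a" "last vs = b" "distinct vs"
    "successively (\<lambda>x y. {x, y} \<in> F) vs"
    using walk_rel_imp_path[OF assms(1)] by blast
  obtain c ws where "vs = a # c # ws" using vs assms
    by (cases vs; cases "tl vs") auto
  moreover from this have "ws \<noteq> []" using vs assms by auto
  ultimately have len: "3 \<le> length vs" by (cases ws) auto
  have "{vs ! i, vs ! (Suc i mod length vs)} \<in> insert {a, b} F" if i: "i < length vs" for i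
  proof (cases "Suc i < length vs")
    case True
    then show ?thesis using vs(5) by (simp add: successively_conv_nth)
  next
    case False
    then have "Suc i = length vs" using i by simp
    then have "vs ! i = b" "vs ! (Suc i mod length vs) = a"
      using vs(1-3) by (auto simp: last_conv_nth hd_conv_nth simp flip: \<open>Suc i = length vs\<close>)
    then show ?thesis by (simp add: insert_commute)
  qed
  then have "graph_cycle (UNIV, insert {a, b} F) vs"
    using len vs(4) by (simp add: graph_cycle_def)
  then show ?thesis by (auto simp: has_cycle_def)
qed

lemma walk_if_has_cycle_insert:
  assumes "has_cycle (insert {a, b} F)" "\<not> has_cycle F"
  shows "(a, b) \<in> walk_rel F"
proof -
  obtain vs where vs: "3 \<le> length vs" "distinct vs"
    and edges: "\<And>i. i < length vs \<Longrightarrow> {vs ! i, vs ! (Suc i mod length vs)} \<in> insert {a, b} F"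
    using assms(1) by (auto simp: has_cycle_def graph_cycle_def)
  define n where "n = length vs"
  have n: "3 \<le> n" using vs by (simp add: n_def)
  obtain i where i: "i < n" "{vs ! i, vs ! (Suc i mod n)} \<notin> F"
    using assms(2) vs by (auto simp: has_cycle_def graph_cycle_def n_def)
  then have ab: "{vs ! i, vs ! (Suc i mod n)} = {a, b}" using edges by (auto simp: n_def)
  have step: "{vs ! j, vs ! (Suc j mod n)} \<in> F" if j: "j < n" "j \<noteq> i" for j
  proof -
    \<comment> \<open>Two positions with the same edge would each follow the other, which is
      impossible in a cycle of length at least three.\<close>
    have "{vs ! j, vs ! (Suc j mod n)} \<noteq> {vs ! i, vs ! (Suc i mod n)}"
    proof
      assume "{vs ! j, vs ! (Suc j mod n)} = {vs ! i, vs ! (Suc i mod n)}"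
      moreover have "Suc i mod n < n" "Suc j mod n < n" using n by simp_all
      ultimately have "j = Suc i mod n" "Suc j mod n = i"
        using vs(2) i(1) j by (auto simp: doubleton_eq_iff nth_eq_iff_index_eq n_def)
      then show False using i(1) n by (auto simp: mod_Suc split: if_splits)
    qed
    then show ?thesis using edges[of j] ab j by (simp add: n_def)
  qed
  \<comment> \<open>Going round the cycle from the vertex after the new edge;
    \<open>m = n - 1\<close> arrives at its other end without using it.\<close>
  have "(vs ! (Suc i mod n), vs ! ((Suc i + m) mod n)) \<in> walk_rel F" if "m < n" for m
    using that
  proof (induction m)
    case (Suc m)
    have "(Suc i + m) mod n \<noteq> i"
      using Suc.prems i(1) by (auto simp: mod_if)
    then have "{vs ! ((Suc i + m) mod n), vs ! (Suc ((Suc i + m) mod n) mod n)} \<in> F"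
      using n by (intro step) auto
    then have "(vs ! ((Suc i + m) mod n), vs ! ((Suc i + Suc m) mod n)) \<in> walk_rel F"
      by (intro walk_rel_edge) (simp add: mod_Suc_eq)
    then show ?case using Suc walk_rel_trans by (metis Suc_lessD)
  qed simp
  from this[of "n - 1"] have "(vs ! (Suc i mod n), vs ! i) \<in> walk_rel F"
    using i n by simp
  then show ?thesis using ab walk_rel_sym by (auto simp: doubleton_eq_iff)
qed

section \<open>Counting the components of a forest\<close>

context
  fixes V :: "'a set"
  assumes finV: "finite V"
begin

definition comp_rel :: "'a set set \<Rightarrow> ('a \<times> 'a) set" where
  "comp_rel F = connected_rel (V, F)"

lemma comp_rel_iff: "(u, v) \<in> comp_rel F \<longleftrightarrow> u \<in> V \<and> v \<in> V \<and> (u, v) \<in> walk_rel F"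
  by (simp add: comp_rel_def connected_rel_def walk_rel_def)

lemma equiv_comp_rel: "equiv V (comp_rel F)"
  by (auto intro!: equivI refl_onI symI transI simp: comp_rel_iff intro: walk_rel_sym walk_rel_trans)

lemma finite_components: "finite (V // comp_rel F)"
  using finV equiv_comp_rel by (metis equiv_type finite_quotient)

lemma card_components_empty: "card (V // comp_rel {}) = card V"
proof -
  have "comp_rel {} = Id_on V" by (auto simp: comp_rel_iff walk_rel_def)
  then have "V // comp_rel {} = (\<lambda>v. {v}) ` V" by (auto simp: quotient_def)
  then show ?thesis by (simp add: card_image)
qed

text \<open>The new edge merges the classes \<open>A\<close> and \<open>B\<close> of its ends and
  leaves every other class unchanged.\<close>

lemma card_components_insert:
  assumes ab: "a \<in> V" "b \<in> V" "(a, b) \<notin> walk_rel F"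
  shows "card (V // comp_rel F) = Suc (card (V // comp_rel (insert {a, b} F)))"
proof -
  let ?R = "comp_rel F" and ?R' = "comp_rel (insert {a, b} F)"
  define A B where "A = ?R `` {a}" and "B = ?R `` {b}"
  have AB: "A \<in> V // ?R" "B \<in> V // ?R" "A \<noteq> B"
    using ab by (auto simp: A_def B_def quotient_def comp_rel_iff)
  have mem: "u \<in> A \<longleftrightarrow> u \<in> V \<and> (a, u) \<in> walk_rel F" "u \<in> B \<longleftrightarrow> u \<in> V \<and> (b, u) \<in> walk_rel F" for u
    using ab by (auto simp: A_def B_def comp_rel_iff)
  have cls: "?R' `` {u} = (if u \<in> A \<union> B then A \<union> B else ?R `` {u})" if "u \<in> V" for u
    using that ab
    by (auto simp: mem comp_rel_iff walk_rel_insert) (meson walk_rel_sym walk_rel_trans)+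
  have sub: "C = A" if "C \<in> V // ?R" "x \<in> C" "x \<in> A" for C x
    using that AB quotient_disj[OF equiv_comp_rel] by blast
  have sub': "C = B" if "C \<in> V // ?R" "x \<in> C" "x \<in> B" for C x
    using that AB quotient_disj[OF equiv_comp_rel] by blast
  have a: "a \<in> A" "b \<in> B" using ab by (auto simp: mem)
  have "V // ?R' = insert (A \<union> B) (V // ?R - {A, B})"
  proof (intro equalityI subsetI)
    fix C assume "C \<in> V // ?R'"
    then obtain u where u: "u \<in> V" "C = ?R' `` {u}" by (auto simp: quotient_def)
    show "C \<in> insert (A \<union> B) (V // ?R - {A, B})"
    proof (cases "u \<in> A \<union> B")
      case False
      moreover have "u \<in> ?R `` {u}" using u by (simp add: comp_rel_iff)
      ultimately show ?thesis using u by (auto simp: cls quotientI)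
    qed (use u cls in auto)
  next
    fix C assume C: "C \<in> insert (A \<union> B) (V // ?R - {A, B})"
    show "C \<in> V // ?R'"
    proof (cases "C = A \<union> B")
      case True
      then have "C = ?R' `` {a}" using ab a cls by auto
      then show ?thesis using ab by (auto simp: quotient_def)
    next
      case False
      then obtain u where u: "u \<in> V" "C = ?R `` {u}" and C': "C \<in> V // ?R" "C \<noteq> A" "C \<noteq> B"
        using C by (auto simp: quotient_def)
      have "u \<in> C" using u by (simp add: comp_rel_iff)
      then have "u \<notin> A \<union> B" using sub sub' C' by blast
      then have "C = ?R' `` {u}" using u cls by auto
      then show ?thesis using u by (auto simp: quotient_def)
    qed
  qed
  moreover have "A \<union> B \<notin> V // ?R - {A, B}" using sub a by blast
  ultimately have "card (V // ?R') = Suc (card (V // ?R - {A, B}))"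
    using finite_components[of F] by simp
  also have "card (V // ?R - {A, B}) = card (V // ?R) - 2"
    using AB by (subst card_Diff_subset) auto
  finally show ?thesis
    using AB finite_components[of F] card_mono[of "V // ?R" "{A, B}"] by simp
qed

lemma card_components_forest:
  assumes "finite F" "\<not> has_cycle F" "\<And>e. e \<in> F \<Longrightarrow> e \<subseteq> V \<and> card e = 2"
  shows "card (V // comp_rel F) + card F = card V"
  using assms
proof (induction F rule: finite_induct)
  case empty
  then show ?case by (simp add: card_components_empty)
next
  case (insert e F)
  obtain a b where e: "e = {a, b}" "a \<noteq> b" "a \<in> V" "b \<in> V"
    using insert.prems(2)[of e] by (auto simp: card_2_iff)
  have "(a, b) \<notin> walk_rel F"
    using has_cycle_insert_if_walk[of a b F] insert e by blast
  then have "card (V // comp_rel F) = Suc (card (V // comp_rel (insert e F)))"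
    using e card_components_insert by simp
  moreover have "card (V // comp_rel F) + card F = card V"
    using insert has_cycle_mono[of F "insert e F"] by blast
  ultimately show ?case using insert by simp
qed

text \<open>If no edge of \<open>B\<close> could be added, every edge of \<open>B\<close> would join
  vertices connected in \<open>A\<close>. Then \<open>A\<close> has at most as many components as
  \<open>B\<close>, hence at least as many edges.\<close>

lemma forest_augment:
  assumes A: "finite A" "\<not> has_cycle A" "\<And>e. e \<in> A \<Longrightarrow> e \<subseteq> V \<and> card e = 2"
    and B: "finite B" "\<not> has_cycle B" "\<And>e. e \<in> B \<Longrightarrow> e \<subseteq> V \<and> card e = 2"
    and less: "card A < card B"
  shows "\<exists>e\<in>B - A. \<not> has_cycle (insert e A)"
proof (rule ccontr)
  assume neg: "\<not> ?thesis"
  have "(a, b) \<in> walk_rel A" if "{a, b} \<in> B" for a b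
    using that neg walk_if_has_cycle_insert[OF _ A(2)] walk_rel_edge[of a b A] by (cases "{a, b} \<in> A") auto
  then have "walk_rel B \<subseteq> walk_rel A"
    unfolding walk_rel_def[of B] by (intro rtrancl_subset_rtrancl[of _ "{(a, b). {a, b} \<in> A}", folded walk_rel_def]) auto
  then have "comp_rel B \<subseteq> comp_rel A" by (auto simp: comp_rel_iff)
  then have "card (V // comp_rel A) \<le> card (V // comp_rel B)"
    using finite_refines_card_le[OF finite_components _ equiv_comp_rel equiv_comp_rel] by blast
  then show False
    using card_components_forest[OF A] card_components_forest[OF B] less by linarith
qed

end

text \<open>Simplicity of the graphic matroid; the case \<open>e = e'\<close> excludes
  loops.\<close>

lemma no_cycle_pair:
  assumes "card e = 2" "card e' = 2"
  shows "\<not> has_cycle {e, e'}"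
proof -
  have empty: "\<not> has_cycle {}"
    by (auto simp: has_cycle_def graph_cycle_def intro: exI[of _ 0])
  obtain a b where e: "e = {a, b}" "a \<noteq> b" using assms(1) by (auto simp: card_2_iff)
  obtain c d where e': "e' = {c, d}" "c \<noteq> d" using assms(2) by (auto simp: card_2_iff)
  have "\<not> has_cycle {e}"
  proof
    assume "has_cycle {e}"
    then have "(a, b) \<in> walk_rel {}" using walk_if_has_cycle_insert[OF _ empty, of a b] e by simp
    then show False using e by (simp add: walk_rel_def)
  qed
  moreover have "(c, d) \<notin> walk_rel {e}" if "e \<noteq> e'"
  proof
    assume "(c, d) \<in> walk_rel {e}"
    then have "c \<in> {a, b} \<and> d \<in> {a, b}"
      using e e'(2) walk_rel_insert[of c d a b "{}"] by (auto simp: walk_rel_def)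
    then show False using that e e' by auto
  qed
  ultimately show ?thesis
    using walk_if_has_cycle_insert[of c d "{e}"] e' by (cases "e = e'") (auto simp: insert_commute)
qed

text \<open>The independent sets of the graphic matroid: edge sets of spanning forests with any
  number of components.\<close>

definition forest_sets :: "'a set \<Rightarrow> 'a set \<Rightarrow> 'a set set set" where
  "forest_sets X Y = {F. F \<subseteq> bipartite_edges X Y \<and> \<not> has_cycle F}"

section \<open>The graphic matroid of the complete bipartite graph\<close>

context
  fixes X Y :: "'a set"
  assumes fin: "finite X" "finite Y" and disj: "X \<inter> Y = {}"
begin

lemma bipartite_edge: "e \<in> bipartite_edges X Y \<Longrightarrow> e \<subseteq> X \<union> Y \<and> card e = 2"
  using disj by (auto simp: bipartite_edges_def card_insert_if)

lemma finite_bipartite_edges: "finite (bipartite_edges X Y)"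
  by (rule finite_subset[of _ "Pow (X \<union> Y)"]) (auto simp: bipartite_edges_def fin)

lemma forest_set_finite: "F \<in> forest_sets X Y \<Longrightarrow> finite F"
  using finite_bipartite_edges finite_subset by (auto simp: forest_sets_def)

lemma forest_set_edge: "F \<in> forest_sets X Y \<Longrightarrow> e \<in> F \<Longrightarrow> e \<subseteq> X \<union> Y \<and> card e = 2"
  using bipartite_edge by (auto simp: forest_sets_def)

lemma forest_set_augment:
  assumes "A \<in> forest_sets X Y" "B \<in> forest_sets X Y" "card A < card B"
  shows "\<exists>e\<in>B - A. insert e A \<in> forest_sets X Y"
proof -
  have "\<exists>e\<in>B - A. \<not> has_cycle (insert e A)"
    using fin assms forest_set_edge[OF assms(1)] forest_set_edge[OF assms(2)] forest_set_finite
    by (intro forest_augment[of "X \<union> Y"]) (auto simp: forest_sets_def)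
  then show ?thesis using assms by (auto simp: forest_sets_def)
qed

lemma card_conn_components:
  assumes "F \<in> forest_sets X Y"
  shows "card (conn_components (X \<union> Y, F)) + card F = card (X \<union> Y)"
  using card_components_forest[of "X \<union> Y" F] forest_set_edge[OF assms] forest_set_finite[OF assms] assms fin
  by (simp add: forest_sets_def conn_components_def comp_rel_def)

text \<open>In a forest the numbers of edges and components add up to the number of vertices. The
  bound on \<open>k\<close> keeps the subtraction of naturals exact.\<close>

lemma bipartite_forests_eq:
  assumes "k \<le> card (X \<union> Y)"
  shows "bipartite_forests X Y k = Pair (X \<union> Y) ` {F \<in> forest_sets X Y. card F = card (X \<union> Y) - k}"
proof -
  have "(V, F) \<in> bipartite_forests X Y k \<longleftrightarrow>
      V = X \<union> Y \<and> F \<in> forest_sets X Y \<and> card F = card (X \<union> Y) - k" for V F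
  proof -
    have "(V, F) \<in> bipartite_forests X Y k \<longleftrightarrow>
        V = X \<union> Y \<and> F \<in> forest_sets X Y \<and> card (conn_components (X \<union> Y, F)) = k"
      using bipartite_edge
      by (auto simp: bipartite_forests_def is_forest_def simple_graph_def forest_sets_def has_cycle_iff[of _ "X \<union> Y"])
    then show ?thesis using card_conn_components[of F] assms by auto
  qed
  then show ?thesis by (auto simp: image_iff)
qed

text \<open>In a forest with the most edges, every missing edge would close a cycle, so its ends are
  already connected. Hence there is one component.\<close>

lemma spanning_forest_exists:
  assumes "X \<noteq> {}" "Y \<noteq> {}"
  shows "\<exists>F\<in>forest_sets X Y. card F = card (X \<union> Y) - 1"
proof -
  have "{} \<in> forest_sets X Y"
    by (auto simp: forest_sets_def has_cycle_def graph_cycle_def intro: exI[of _ 0])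
  moreover have "card F \<le> card (bipartite_edges X Y)" if "F \<in> forest_sets X Y" for F
    using that finite_bipartite_edges by (simp add: forest_sets_def card_mono)
  ultimately have "\<exists>F. F \<in> forest_sets X Y \<and> (\<forall>G. G \<in> forest_sets X Y \<longrightarrow> card G \<le> card F)"
    by (intro ex_has_greatest_nat[of _ "{}" _ "Suc (card (bipartite_edges X Y))"]) (auto simp: less_Suc_eq_le)
  then obtain F where F: "F \<in> forest_sets X Y" and max: "\<And>G. G \<in> forest_sets X Y \<Longrightarrow> card G \<le> card F"
    by blast
  have XY: "(x, y) \<in> walk_rel F" if xy: "x \<in> X" "y \<in> Y" for x y
  proof (cases "{x, y} \<in> F")
    case False
    then have "card (insert {x, y} F) > card F" using forest_set_finite[OF F] by simp
    then have "insert {x, y} F \<notin> forest_sets X Y" using max leD by blast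
    then have "has_cycle (insert {x, y} F)" using F xy by (auto simp: forest_sets_def bipartite_edges_def)
    then show ?thesis using walk_if_has_cycle_insert F by (auto simp: forest_sets_def)
  qed (simp add: walk_rel_edge)
  obtain x0 y0 where xy0: "x0 \<in> X" "y0 \<in> Y" using assms by blast
  have to_x0: "(v, x0) \<in> walk_rel F" if "v \<in> X \<union> Y" for v
    using that walk_rel_trans[OF XY[OF _ xy0(2)] walk_rel_sym[OF XY[OF xy0]], of v]
      walk_rel_sym[OF XY[OF xy0(1)], of v] by auto
  have "connected_rel (X \<union> Y, F) = (X \<union> Y) \<times> (X \<union> Y)"
    using walk_rel_trans[OF to_x0 walk_rel_sym[OF to_x0]]
    unfolding connected_rel_def walk_rel_def by auto
  then have "conn_components (X \<union> Y, F) = {X \<union> Y}"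
    using xy0 by (auto simp: conn_components_def quotient_def)
  then show ?thesis using card_conn_components[OF F] F by force
qed

lemma matroid_forest_sets:
  assumes "X \<noteq> {}" "Y \<noteq> {}" "r < card (X \<union> Y)"
  shows "finite_matroid (bipartite_edges X Y) (forest_sets X Y) r"
proof
  show "finite (bipartite_edges X Y)" by (rule finite_bipartite_edges)
  show sub: "B \<in> forest_sets X Y" if "A \<in> forest_sets X Y" "B \<subseteq> A" for A B
    using that has_cycle_mono by (auto simp: forest_sets_def)
  show "\<exists>x\<in>B - A. insert x A \<in> forest_sets X Y"
    if "A \<in> forest_sets X Y" "B \<in> forest_sets X Y" "card A < card B" for A B
    using that by (rule forest_set_augment)
  obtain F where F: "F \<in> forest_sets X Y" "card F = card (X \<union> Y) - 1"
    using spanning_forest_exists[OF assms(1,2)] by blast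
  then have "r \<le> card F" using assms(3) by linarith
  then obtain G where "G \<subseteq> F" "card G = r" by (rule obtain_subset_with_card_n)
  then show "\<exists>B\<in>forest_sets X Y. card B = r" using sub F by blast
qed (auto simp: forest_sets_def)

lemma pair_forest_set:
  "e \<in> bipartite_edges X Y \<Longrightarrow> e' \<in> bipartite_edges X Y \<Longrightarrow> {e, e'} \<in> forest_sets X Y"
  using no_cycle_pair bipartite_edge by (auto simp: forest_sets_def)

end

section \<open>The Hessian of the forest polynomial\<close>

text \<open>Each monomial is either linear in \<open>x e\<close> or free of it. The indexed family
  \<open>g\<close> lets the lemma apply again to its own result, with \<open>e\<close> removed from
  each set.\<close>

lemma partial_deriv_sum_prod:
  fixes g :: "'i \<Rightarrow> 'v set"
  assumes "\<And>i. i \<in> I \<Longrightarrow> finite (g i)" and "finite I"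
  shows "partial_deriv e (\<lambda>x. \<Sum>i\<in>I. \<Prod>f\<in>g i. x f) =
         (\<lambda>x. \<Sum>i | i \<in> I \<and> e \<in> g i. \<Prod>f\<in>g i - {e}. x f)"
proof
  fix x :: "'v \<Rightarrow> real"
  have "((\<lambda>t. \<Prod>f\<in>g i. (x(e := t)) f) has_real_derivative
      (if e \<in> g i then \<Prod>f\<in>g i - {e}. x f else 0)) (at (x e))" if "i \<in> I" for i
  proof (cases "e \<in> g i")
    case True
    have "(\<Prod>f\<in>g i. (x(e := t)) f) = t * (\<Prod>f\<in>g i - {e}. x f)" for t
    proof -
      have "(\<Prod>f\<in>g i. (x(e := t)) f) = t * (\<Prod>f\<in>g i - {e}. (x(e := t)) f)"
        using prod.remove[OF assms(1)[OF that] True, of "x(e := t)"] by simp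
      also have "(\<Prod>f\<in>g i - {e}. (x(e := t)) f) = (\<Prod>f\<in>g i - {e}. x f)"
        by (rule prod.cong) auto
      finally show ?thesis .
    qed
    then show ?thesis using True by (auto intro!: derivative_eq_intros)
  next
    case False
    then have "(\<Prod>f\<in>g i. (x(e := t)) f) = (\<Prod>f\<in>g i. x f)" for t
      by (intro prod.cong) auto
    then show ?thesis using False by simp
  qed
  then have "((\<lambda>t. \<Sum>i\<in>I. \<Prod>f\<in>g i. (x(e := t)) f) has_real_derivative
      (\<Sum>i\<in>I. if e \<in> g i then \<Prod>f\<in>g i - {e}. x f else 0)) (at (x e))"
    by (rule DERIV_sum)
  then show "partial_deriv e (\<lambda>x. \<Sum>i\<in>I. \<Prod>f\<in>g i. x f) x =
      (\<Sum>i | i \<in> I \<and> e \<in> g i. \<Prod>f\<in>g i - {e}. x f)"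
    unfolding partial_deriv_def using DERIV_imp_deriv assms(2) by (simp add: sum.inter_filter)
qed

lemma second_partial_deriv_sum_prod_one:
  assumes fin: "finite \<B>" "\<And>B. B \<in> \<B> \<Longrightarrow> finite B"
  shows "partial_deriv e' (partial_deriv e (\<lambda>x. \<Sum>B\<in>\<B>. \<Prod>f\<in>B. x f)) (\<lambda>_. 1) =
         (if e' \<noteq> e then real (card {B \<in> \<B>. {e', e} \<subseteq> B}) else 0)"
proof -
  have "partial_deriv e' (partial_deriv e (\<lambda>x. \<Sum>B\<in>\<B>. \<Prod>f\<in>B. x f)) (\<lambda>_. 1) =
      real (card {B. (B \<in> \<B> \<and> e \<in> B) \<and> e' \<in> B - {e}})"
    using fin
    by (subst partial_deriv_sum_prod[where g = "\<lambda>B. B"], simp_all)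
      (subst partial_deriv_sum_prod[where g = "\<lambda>B. B - {e}"], simp_all)
  also have "{B. (B \<in> \<B> \<and> e \<in> B) \<and> e' \<in> B - {e}} = (if e' \<noteq> e then {B \<in> \<B>. {e', e} \<subseteq> B} else {})"
    by auto
  finally show ?thesis by simp
qed

lemma bform_reindex:
  assumes "bij_betw f L E"
  shows "bform L (\<lambda>i j. h (f i) (f j)) (\<lambda>i. v (f i)) (\<lambda>i. w (f i)) = bform E h v w"
proof -
  have "(\<Sum>j\<in>L. h (f i) (f j) * v (f i) * w (f j)) = (\<Sum>e\<in>E. h (f i) e * v (f i) * w e)" for i
    by (rule sum.reindex_bij_betw[OF assms])
  then show ?thesis unfolding bform_def using sum.reindex_bij_betw[OF assms] by simp
qed

theorem theorem2p11:
  fixes X Y :: "'a set" and k :: nat and es :: "'a set list"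
  assumes "finite X" and "finite Y" and "X \<inter> Y = {}"
    and "2 \<le> card X" and "2 \<le> card Y"
    and "0 < k" and "k < card X + card Y - 2"
    and "distinct es" and "set es = bipartite_edges X Y"
  shows "det (hessian es (forest_poly X Y k) (\<lambda>_. 1)) \<noteq> 0 \<and>
         num_pos_eigenvalues (hessian es (forest_poly X Y k) (\<lambda>_. 1)) = 1"
proof -
  define E where "E = bipartite_edges X Y"
  define r where "r = card (X \<union> Y) - k"
  define n where "n = length es"
  have N: "card (X \<union> Y) = card X + card Y" using assms by (simp add: card_Un_disjoint)
  \<comment> \<open>The upper bound on \<open>k\<close> gives rank at least two, and
    \<open>0 < k\<close> keeps \<open>r\<close> at most the size of a spanning tree.\<close>
  have r: "2 \<le> r" "r < card (X \<union> Y)" and k: "k \<le> card (X \<union> Y)" using assms N by (auto simp: r_def)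
  interpret M: finite_matroid E "forest_sets X Y" r
    unfolding E_def using assms r by (intro matroid_forest_sets) auto
  let ?h = "\<lambda>i j. M.hess {} (es ! i) (es ! j)"
  let ?B = "{F \<in> forest_sets X Y. card F = r}"
  have "forest_poly X Y k = (\<lambda>x. \<Sum>B\<in>?B. \<Prod>f\<in>B. x f)"
    unfolding forest_poly_def bipartite_forests_eq[OF assms(1-3) k] r_def[symmetric]
    by (subst sum.reindex) (auto simp: inj_on_def)
  moreover have "partial_deriv e' (partial_deriv e (\<lambda>x. \<Sum>B\<in>?B. \<Prod>f\<in>B. x f)) (\<lambda>_. 1) = M.hess {} e' e" for e e'
  proof -
    have "{B \<in> ?B. {e', e} \<subseteq> B} = {B \<in> forest_sets X Y. card B = r \<and> {e', e} \<subseteq> B}" by auto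
    then show ?thesis
      using M.finite_indep M.indep_finite
      by (subst second_partial_deriv_sum_prod_one) (auto simp: M.hess_def M.count_bases_def)
  qed
  ultimately have H: "hessian es (forest_poly X Y k) (\<lambda>_. 1) = mat n n (\<lambda>(i, j). ?h i j)"
    by (simp add: hessian_def n_def)
  have bij: "bij_betw (\<lambda>i. es ! i) {..<n} E"
    using assms(8,9) bij_betw_nth[of es "{..<n}" E] by (simp add: n_def E_def)
  \<comment> \<open>Through \<open>idx\<close> a vector indexed by positions in \<open>es\<close>
    becomes a function on edges, to which the matroid results apply.\<close>
  define idx where "idx = inv_into {..<n} (\<lambda>i. es ! i)"
  have idx: "idx (es ! i) = i" if "i < n" for i
    using bij that by (simp add: idx_def bij_betw_def inv_into_f_f)
  have sum_reindex: "(\<Sum>j<n. f (es ! j)) = (\<Sum>e\<in>E. f e)" for f :: "'a set \<Rightarrow> real"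
    by (rule sum.reindex_bij_betw[OF bij])
  have empty: "{} \<in> forest_sets X Y" using M.rank_ge M.hereditary by blast
  have inj: "x i = 0" if ker: "\<And>i. i < n \<Longrightarrow> (\<Sum>j<n. ?h i j * x j) = 0" and i: "i < n" for x i
  proof -
    have "(\<Sum>e\<in>E. M.hess {} e' e * x (idx e)) = 0" if e': "e' \<in> E" for e'
    proof -
      obtain i' where i': "i' < n" "e' = es ! i'" using bij e' by (auto simp: bij_betw_def)
      have "(\<Sum>e\<in>E. M.hess {} e' e * x (idx e)) = (\<Sum>j<n. M.hess {} e' (es ! j) * x (idx (es ! j)))"
        by (rule sum_reindex[symmetric])
      also have "\<dots> = 0" using ker[OF i'(1)] by (simp add: idx i')
      finally show ?thesis .
    qed
    moreover have "es ! i \<in> E" using bij i by (auto simp: bij_betw_def)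
    ultimately have "x (idx (es ! i)) = 0"
      using M.hess_kernel_trivial[OF r(1), of "\<lambda>e. x (idx e)"] pair_forest_set[OF assms(1-3)]
      by (simp add: E_def)
    then show ?thesis by (simp add: idx i)
  qed
  have reindex: "bform {..<n} ?h v w = bform E (M.hess {}) (\<lambda>e. v (idx e)) (\<lambda>e. w (idx e))" for v w
  proof -
    have "bform {..<n} ?h v w = bform {..<n} ?h (\<lambda>i. v (idx (es ! i))) (\<lambda>i. w (idx (es ! i)))"
      unfolding bform_def by (intro sum.cong refl) (simp add: idx)
    also have "\<dots> = bform E (M.hess {}) (\<lambda>e. v (idx e)) (\<lambda>e. w (idx e))"
      by (rule bform_reindex[OF bij, where h = "M.hess {}"])
    finally show ?thesis .
  qed
  have "num_pos_eigenvalues (mat n n (\<lambda>(i, j). ?h i j)) = 1"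
  proof (rule num_pos_eigenvalues_eq_1)
    show "?h i j = ?h j i" for i j by (rule M.hess_sym)
    show "x i = 0" if "\<And>i. i < n \<Longrightarrow> (\<Sum>j<n. ?h i j * x j) = 0" "i < n" for x i
      using that by (rule inj)
    show "0 < bform {..<n} ?h (\<lambda>_. 1) (\<lambda>_. 1)"
      unfolding reindex using r by (intro M.bform_hess_one_pos empty) simp
    show "bform {..<n} ?h w w \<le> 0" if "bform {..<n} ?h (\<lambda>_. 1) w = 0" for w
      using that r unfolding reindex
      by (intro M.hess_nonpos_on_orthogonal[OF empty, of "r - 2"]) auto
  qed
  moreover have "det (mat n n (\<lambda>(i, j). ?h i j)) \<noteq> 0"
    unfolding det_mat_eq_0_iff using inj by blast
  ultimately show ?thesis unfolding H by blast
qed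

end
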